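(* Let $n\ge0$. Let $B_n(t)=\sum_{w\in K(B_n)}t^{\mathrm{des}_B(w)}$ and $S_{n+1}(t)=\sum_{w\in K(S_{n+1})}t^{\mathrm{des}_A(w)}$. Then $B_n(t)=S_{n+1}(t)$, and consequently $$B_n(t)=\sum_{k=0}^{\lfloor n/2\rfloor}\gamma^B_{n,k}\,t^k(1+t)^{n-2k},$$ where $$\gamma^B_{n,k}=\#\{w\in K(B_n)\mid \mathrm{dd}_B(w)=0,\ \mathrm{des}_B(w)=k\}=\gamma^S_{n+1,k},\qquad \gamma^S_{n+1,k}=\#\{w\in K(S_{n+1})\mid \mathrm{dd}_A(w)=0,\ \mathrm{des}_A(w)=k\}.$$ Therefore, the polynomial $B_n(t)$ is $\gamma$-positive, and hence palindromic and unimodal.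
   Context: Notation: $[m,n]=\{m,\dots,n\}$, $[n]=[1,n]$, $\bar a=-a$. $S_n$ is the symmetric group on $[n]$. $B_n$ is the group of signed permutations: bijections $w$ of $\{\pm1,\dots,\pm n\}$ with $w(-i)=-w(i)$, written $w=w_1\cdots w_n$, $w_i=w(i)$; $S_n\subseteq B_n$ consists of those with all $w_i>0$. $B_0$ consists of the empty signed permutation. For a word $a=a_1\cdots a_m$ of nonzero integers with distinct absolute values, $\mathrm{sts}(a)\in B_m$ is the signed permutation whose $i$-th entry has the sign of $a_i$ and whose absolute values have the same relative order as $|a_1|,\dots,|a_m|$. $w$ contains the pattern $u\in B_m$ if $\mathrm{sts}(w_{i_1}\cdots w_{i_m})=u$ for some $i_1<\cdots<i_m$; otherwise it avoids $u$. $K(B_n)$ is the set of separable $w\in B_n$, i.e. those avoiding $\bar21$, $2\bar1$, $3142$, $2413$, $\bar3\,\bar1\,\bar4\,\bar2$, $\bar2\,\bar4\,\bar1\,\bar3$. $K(S_n)=K(B_n)\cap S_n$ is the set of permutations avoiding $3142$ and $2413$. For $w\in B_n$, with conventions $w_0=0$, $w_{-1}=w_{n+1}=+\infty$: $\mathrm{des}_B(w)=\#\{i\in[0,n]: w_i>w_{i+1}\}$ and $\mathrm{dd}_B(w)=\#\{i\in[0,n]: w_{i-1}>w_i>w_{i+1}\}$. For $w\in S_n$, with conventions $w_0=w_{n+1}=+\infty$: $\mathrm{des}_A(w)=\#\{i\in[n]:w_i>w_{i+1}\}$ and $\mathrm{dd}_A(w)=\#\{i\in[n]:w_{i-1}>w_i>w_{i+1}\}$.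 A polynomial is $\gamma$-positive (with respect to degree $n$) if it can be written as $\sum_{k=0}^{\lfloor n/2\rfloor}\gamma_k t^k(1+t)^{n-2k}$ with all $\gamma_k\ge0$. A polynomial $\sum_{i=0}^n a_it^i$ of degree $n$ is palindromic if $a_i=a_{n-i}$ for all $i$, and unimodal if $a_0\le\cdots\le a_j\ge\cdots\ge a_n$ for some $j$. *)

theory Defs
  imports
    "HOL-Library.Extended_Real"
    "HOL-Library.Sublist"
    "HOL-Combinatorics.Permutations"
    "HOL-Computational_Algebra.Polynomial"
begin

(* Signed permutations are functions on int; permutes makes them the identity off
   {-n..n} - {0}, so that each bijection is represented exactly once. *)
definition signed_perms :: "nat \<Rightarrow> (int \<Rightarrow> int) set" where
  "signed_perms n =
     {w. w permutes ({- int n..int n} - {0}) \<and>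
         (\<forall>i \<in> {- int n..int n} - {0}. w (- i) = - w i)}"

definition unsigned_perms :: "nat \<Rightarrow> (int \<Rightarrow> int) set" where
  "unsigned_perms n = {w \<in> signed_perms n. \<forall>i \<in> {1..int n}. w i > 0}"

lemma finite_signed_perms: "finite (signed_perms n)"
proof -
  have "finite {w. w permutes ({- int n..int n} - {0})}"
    by (rule finite_permutations) simp
  then show ?thesis
    by (rule rev_finite_subset) (auto simp: signed_perms_def)
qed

definition one_line :: "nat \<Rightarrow> (int \<Rightarrow> int) \<Rightarrow> int list" where
  "one_line n w = map w [1..int n]"

(* The signed standardization in one-line notation: each letter keeps its sign, and its
   absolute value is replaced by its rank among all absolute values.  It is meant for words
   of nonzero integers with distinct absolute values. *)
definition sts :: "int list \<Rightarrow> int list" where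
  "sts a = map (\<lambda>x. sgn x * int (card {y \<in> set a. \<bar>y\<bar> \<le> \<bar>x\<bar>})) a"

lemma length_sts: "length (sts a) = length a"
  by (simp add: sts_def)

lemma sgn_sts:
  assumes "i < length a"
  shows "sgn (sts a ! i) = sgn (a ! i)"
proof -
  have "a ! i \<in> {y \<in> set a. \<bar>y\<bar> \<le> \<bar>a ! i\<bar>}"
    using assms by simp
  then have "card {y \<in> set a. \<bar>y\<bar> \<le> \<bar>a ! i\<bar>} > 0"
    by (subst card_gt_0_iff) auto
  then show ?thesis
    using assms by (simp add: sts_def sgn_mult)
qed

lemma abs_sts_less_iff:
  assumes "0 \<notin> set a" "i < length a" "j < length a"
  shows "\<bar>sts a ! i\<bar> < \<bar>sts a ! j\<bar> \<longleftrightarrow> \<bar>a ! i\<bar> < \<bar>a ! j\<bar>"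
proof -
  let ?R = "\<lambda>x. {y \<in> set a. \<bar>y\<bar> \<le> \<bar>x\<bar>}"
  have abs: "\<bar>sts a ! k\<bar> = int (card (?R (a ! k)))" if "k < length a" for k
  proof -
    have "a ! k \<noteq> 0" using assms(1) that nth_mem by metis
    then show ?thesis using that by (simp add: sts_def abs_mult)
  qed
  have le: "card (?R x) \<le> card (?R y)" if "\<bar>x\<bar> \<le> \<bar>y\<bar>" for x y
    using that by (intro card_mono) auto
  have less: "card (?R x) < card (?R y)" if "\<bar>x\<bar> < \<bar>y\<bar>" "y \<in> set a" for x y
  proof (rule psubset_card_mono)
    have "y \<in> ?R y - ?R x" using that by simp
    moreover have "?R x \<subseteq> ?R y" using that by auto
    ultimately show "?R x \<subset> ?R y" by blast
  qed simp
  show ?thesis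
    using abs[OF assms(2)] abs[OF assms(3)] le[of "a ! j" "a ! i"]
      less[of "a ! i" "a ! j"] assms(3)
    by (cases "\<bar>a ! i\<bar> < \<bar>a ! j\<bar>") auto
qed

(* Patterns are given by their one-line notation. *)
definition contains_pattern :: "nat \<Rightarrow> (int \<Rightarrow> int) \<Rightarrow> int list \<Rightarrow> bool" where
  "contains_pattern n w u \<longleftrightarrow> (\<exists>v. subseq v (one_line n w) \<and> sts v = u)"

definition separable_patterns :: "int list set" where
  "separable_patterns =
     {[-2, 1], [2, -1], [3, 1, 4, 2], [2, 4, 1, 3], [-3, -1, -4, -2], [-2, -4, -1, -3]}"

definition KB :: "nat \<Rightarrow> (int \<Rightarrow> int) set" where
  "KB n = {w \<in> signed_perms n. \<forall>u \<in> separable_patterns. \<not> contains_pattern n w u}"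

definition KS :: "nat \<Rightarrow> (int \<Rightarrow> int) set" where
  "KS n = KB n \<inter> unsigned_perms n"

(* The letter functions encode the boundary conventions.  In type B the letter at
   index -1 is infinity; it is not the value of w at -1. *)
definition letter_B :: "nat \<Rightarrow> (int \<Rightarrow> int) \<Rightarrow> int \<Rightarrow> ereal" where
  "letter_B n w i =
     (if i = 0 then 0
      else if i = -1 \<or> i = int n + 1 then \<infinity>
      else ereal (of_int (w i)))"

definition des_B :: "nat \<Rightarrow> (int \<Rightarrow> int) \<Rightarrow> nat" where
  "des_B n w = card {i \<in> {0..int n}. letter_B n w i > letter_B n w (i + 1)}"

definition dd_B :: "nat \<Rightarrow> (int \<Rightarrow> int) \<Rightarrow> nat" where
  "dd_B n w =
     card {i \<in> {0..int n}. letter_B n w (i - 1) > letter_B n w i \<and>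
                            letter_B n w i > letter_B n w (i + 1)}"

definition letter_A :: "nat \<Rightarrow> (int \<Rightarrow> int) \<Rightarrow> int \<Rightarrow> ereal" where
  "letter_A n w i = (if i = 0 \<or> i = int n + 1 then \<infinity> else ereal (of_int (w i)))"

definition des_A :: "nat \<Rightarrow> (int \<Rightarrow> int) \<Rightarrow> nat" where
  "des_A n w = card {i \<in> {1..int n}. letter_A n w i > letter_A n w (i + 1)}"

definition dd_A :: "nat \<Rightarrow> (int \<Rightarrow> int) \<Rightarrow> nat" where
  "dd_A n w =
     card {i \<in> {1..int n}. letter_A n w (i - 1) > letter_A n w i \<and>
                            letter_A n w i > letter_A n w (i + 1)}"

definition poly_B :: "nat \<Rightarrow> int poly" where
  "poly_B n = (\<Sum>w\<in>KB n. monom 1 (des_B n w))"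

definition poly_S :: "nat \<Rightarrow> int poly" where
  "poly_S n = (\<Sum>w\<in>KS n. monom 1 (des_A n w))"

definition gamma_B :: "nat \<Rightarrow> nat \<Rightarrow> nat" where
  "gamma_B n k = card {w \<in> KB n. dd_B n w = 0 \<and> des_B n w = k}"

definition gamma_S :: "nat \<Rightarrow> nat \<Rightarrow> nat" where
  "gamma_S n k = card {w \<in> KS n. dd_A n w = 0 \<and> des_A n w = k}"

definition gamma_expansion :: "nat \<Rightarrow> (nat \<Rightarrow> 'a::comm_ring_1) \<Rightarrow> 'a poly" where
  "gamma_expansion n \<gamma> =
     (\<Sum>k = 0..n div 2. smult (\<gamma> k) (monom 1 k * [:1, 1:] ^ (n - 2 * k)))"

definition gamma_positive :: "nat \<Rightarrow> 'a::linordered_idom poly \<Rightarrow> bool" where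
  "gamma_positive n p \<longleftrightarrow>
     (\<exists>\<gamma>. (\<forall>k \<le> n div 2. \<gamma> k \<ge> 0) \<and> p = gamma_expansion n \<gamma>)"

definition palindromic :: "'a::zero poly \<Rightarrow> bool" where
  "palindromic p \<longleftrightarrow> (\<forall>i \<le> degree p. coeff p i = coeff p (degree p - i))"

definition unimodal :: "'a::{zero,linorder} poly \<Rightarrow> bool" where
  "unimodal p \<longleftrightarrow>
     (\<exists>j \<le> degree p. (\<forall>i < j. coeff p i \<le> coeff p (i + 1)) \<and>
                      (\<forall>i \<in> {j..<degree p}. coeff p i \<ge> coeff p (i + 1)))"

end

theory Submission
  imports Defs "HOL-Computational_Algebra.Formal_Power_Series"
begin

text \<open>
  Type B reduces to type A by a bijection: for a separable signed permutation w, the word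
  0, w(1), ..., w(n) standardizes to a separable permutation of n + 1 letters with the same
  descents and double descents.  It can be inverted because letters of opposite signs of w have
  increasing absolute values, so that the order of the absolute values is determined by the
  order of the letters.

  For type A, weight a separable word by the product over its letters of 1 (valley), a (double
  ascent), d (double descent) or p (peak).  Splitting off the first component of a direct or
  skew sum, and using that a word of length at least 2 is exactly one of the two, gives a
  system for the four generating functions indexed by the boundary conventions.  Eliminating the
  indecomposables yields A = x (1 + (a + d) A + p A^2) + p A^3, which only involves a + d.
  Hence the weights (a, d, p) = (1, t, t), which count descents, may be replaced by (1 + t, 0, t),
  which give the gamma expansion.
\<close>

section \<open>The functional equation\<close>

text \<open>Cutting a word creates new ends whose outer neighbour is a letter of the other component
  instead of infinity, so the series A with infinity on both sides does not satisfy a closed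
  recursion and all four boundary types have to be carried along. The equations for the two mixed
  boundary types mirror each other; adding them is what eliminates their series, and this is why a
  and d survive only as a + d. The cubic then determines A, because A has zero constant term. In
  type B the delicate direction is the inverse. The word 0, w(1), ..., w(n) does not show directly
  how a positive and a negative letter compare in absolute value; position decides. For an arbitrary
  separable word this prescribes a relation between positions that has to be a total order before
  ranks can serve as absolute values, and its transitivity is where separability with the first
  letter in the role of 0 is used. Palindromicity refers to the actual degree, so the expansion must
  be complemented by a nonzero coefficient at k = 0, which the identity permutation
  provides.\<close>

lemma cubic_fps_unique:
  fixes A A' q p :: "'a::idom fps"
  assumes "A = fps_X * (1 + q * A + p * A ^ 2) + p * A ^ 3"
    and "A' = fps_X * (1 + q * A' + p * A' ^ 2) + p * A' ^ 3"
    and "fps_nth A 0 = 0" "fps_nth A' 0 = 0"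
  shows "A = A'"
proof -
  \<comment> \<open>The difference of the two equations factors as \<open>(A - A') * ?f\<close>.
    Since \<open>A\<close> and \<open>A'\<close> have no constant term, that of \<open>?f\<close> is
    1, so \<open>?f\<close> can be cancelled.\<close>
  let ?f = "1 - fps_X * (q + p * (A + A')) - p * (A ^ 2 + A * A' + A' ^ 2)"
  have "(A - A') * ?f =
      (A - (fps_X * (1 + q * A + p * A ^ 2) + p * A ^ 3))
      - (A' - (fps_X * (1 + q * A' + p * A' ^ 2) + p * A' ^ 3))"
    by algebra
  also have "\<dots> = 0"
    using assms(1,2) by simp
  finally have "(A - A') * ?f = 0" .
  moreover have "fps_nth ?f 0 = 1"
    using assms(3,4) by (simp add: power2_eq_square)
  then have "?f \<noteq> 0"
    by (metis fps_zero_nth zero_neq_one)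
  ultimately show ?thesis
    by simp
qed

text \<open>\<open>S\<close> stands for all nonempty separable words, \<open>I\<close> and
  \<open>J\<close> for the sum and the skew indecomposable ones, the flags for the two boundaries
  (\<open>True\<close>: the outer neighbour is larger). The term with \<open>X l r\<close> in
  \<open>IJ\<close> is the one-letter word, which is indecomposable in both senses.\<close>

lemma decomposition_system_cubic:
  fixes S I J :: "bool \<Rightarrow> bool \<Rightarrow> 'a::idom fps" and X :: "bool \<Rightarrow> bool \<Rightarrow> 'a"
  assumes zero: "\<And>l r. fps_nth (S l r) 0 = 0"
    and I: "\<And>l r. S l r = I l r + I l True * S False r"
    and J: "\<And>l r. S l r = J l r + J l False * S True r"
    and IJ: "\<And>l r. S l r + fps_const (X l r) * fps_X = I l r + J l r"
    and valley: "X True True = 1"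
  shows "S True True = fps_X * (1 + fps_const (X False True + X True False) * S True True
             + fps_const (X False False) * S True True ^ 2)
           + fps_const (X False False) * S True True ^ 3"
proof -
  define A B C D where ABCD: "A = S True True" "B = S True False" "C = S False True" "D = S False False"
  define a d p where adp: "a = fps_const (X False True)" "d = fps_const (X True False)"
    "p = fps_const (X False False)"
  \<comment> \<open>Eliminating \<open>I\<close> and \<open>J\<close> gives x = A (1/(1+B) + 1/(1+C)
    - 1); \<open>N\<close> is the bracket after multiplication by (1+B)(1+C).\<close>
  define N where "N = (1 + B) + (1 + C) - (1 + B) * (1 + C)"
  have I': "A = I True True * (1 + C)" "C = I False True * (1 + C)"
    "B = I True False + I True True * D" "D = I False False + I False True * D"
    using I[of True True] I[of False True] I[of True False] I[of False False]
    by (simp_all add: ABCD algebra_simps)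
  have J': "B = J True False * (1 + B)" "D = J False False * (1 + B)"
    "A = J True True + J True False * A" "C = J False True + J False False * A"
    using J[of True True] J[of False True] J[of True False] J[of False False]
    by (simp_all add: ABCD algebra_simps)
  have IJ': "A + fps_X = I True True + J True True" "C + a * fps_X = I False True + J False True"
    "B + d * fps_X = I True False + J True False" "D + p * fps_X = I False False + J False False"
    using IJ[of True True] IJ[of False True] IJ[of True False] IJ[of False False] valley
    by (simp_all add: ABCD adp)
  have nz: "1 + B \<noteq> 0" "1 + C \<noteq> 0" "N \<noteq> 0"
  proof -
    have "fps_nth (1 + B) 0 = 1" "fps_nth (1 + C) 0 = 1" "fps_nth N 0 = 1"
      by (simp_all add: zero ABCD N_def)
    then show "1 + B \<noteq> 0" "1 + C \<noteq> 0" "N \<noteq> 0"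
      by (metis fps_zero_nth zero_neq_one)+
  qed
  have AN: "A * N = fps_X * ((1 + B) * (1 + C))"
    unfolding N_def using I'(1) J'(1,3) IJ'(1) by algebra
  \<comment> \<open>\<open>D\<close> obeys the equation of \<open>A\<close> with x replaced by p x,
    which forces D = p A.\<close>
  have DN: "D * N = p * fps_X * ((1 + B) * (1 + C))"
    unfolding N_def using I'(2,4) J'(2) IJ'(4) by algebra
  have "(D - p * A) * N = 0"
    using AN DN by algebra
  then have D: "D = p * A"
    using nz by simp
  \<comment> \<open>With denominators this reads 1 - d x = 1/(1+B) + A D/(1+C); the equation for
    \<open>a\<close> is the same with \<open>B\<close> and \<open>C\<close> exchanged.\<close>
  have d: "(1 - d * fps_X) * ((1 + B) * (1 + C)) = (1 + C) + A * D * (1 + B)"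
    using I'(1,3) J'(1) IJ'(3) by algebra
  have a: "(1 - a * fps_X) * ((1 + B) * (1 + C)) = (1 + B) + A * D * (1 + C)"
    using I'(2) J'(2,4) IJ'(2) by algebra
  \<comment> \<open>In the sum of the two equations, \<open>B\<close> and \<open>C\<close> occur
    only through (1+B) + (1+C) and (1+B)(1+C), whose ratio is known from \<open>AN\<close>.\<close>
  have "(A - (fps_X * (1 + (a + d) * A + p * A ^ 2) + p * A ^ 3)) * ((1 + B) * (1 + C)) = 0"
    using AN a d unfolding D N_def by algebra
  then have "A = fps_X * (1 + (a + d) * A + p * A ^ 2) + p * A ^ 3"
    using nz by simp
  then show ?thesis
    by (simp add: ABCD adp flip: fps_const_add)
qed

section \<open>Sum and skew decomposition of separable words\<close>

text \<open>The first conjunct excludes 3142 and the second 2413. Comparing letters directly, rather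
  than through \<open>sts\<close>, lets the notion apply to words with 0 and with letters of both
  signs.\<close>

definition order_separable :: "int list \<Rightarrow> bool" where
  "order_separable xs \<longleftrightarrow> (\<forall>i j k l. i < j \<longrightarrow> j < k \<longrightarrow> k < l \<longrightarrow> l < length xs \<longrightarrow>
     \<not> (xs ! j < xs ! l \<and> xs ! l < xs ! i \<and> xs ! i < xs ! k) \<and>
     \<not> (xs ! k < xs ! i \<and> xs ! i < xs ! l \<and> xs ! l < xs ! j))"

lemma order_separableD:
  assumes "order_separable xs" "i < j" "j < k" "k < l" "l < length xs"
  shows "\<not> (xs ! j < xs ! l \<and> xs ! l < xs ! i \<and> xs ! i < xs ! k)"
    and "\<not> (xs ! k < xs ! i \<and> xs ! i < xs ! l \<and> xs ! l < xs ! j)"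
  using assms unfolding order_separable_def by blast+

lemma order_separable_embed:
  assumes "order_separable xs"
    and "\<And>i. i < length ys \<Longrightarrow> f i < length xs"
    and "\<And>i j. i < j \<Longrightarrow> j < length ys \<Longrightarrow> f i < f j"
    and "\<And>i j. i < length ys \<Longrightarrow> j < length ys \<Longrightarrow> ys ! i < ys ! j \<longleftrightarrow> xs ! f i < xs ! f j"
  shows "order_separable ys"
  unfolding order_separable_def
proof (intro allI impI)
  fix i j k l assume *: "i < j" "j < k" "k < l" "l < length ys"
  then have "f i < f j" "f j < f k" "f k < f l" "f l < length xs"
    using assms(2,3) by auto
  moreover have "i < length ys" "j < length ys" "k < length ys" "l < length ys"
    using * by auto
  ultimately show "\<not> (ys ! j < ys ! l \<and> ys ! l < ys ! i \<and> ys ! i < ys ! k) \<and>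
     \<not> (ys ! k < ys ! i \<and> ys ! i < ys ! l \<and> ys ! l < ys ! j)"
    using assms(1,4) unfolding order_separable_def by blast
qed

text \<open>Reversing the order of values exchanges 3142 and 2413.\<close>

lemma order_separable_diff:
  assumes "order_separable xs"
  shows "order_separable (map ((-) c) xs)"
  unfolding order_separable_def
proof (intro allI impI)
  fix i j k l assume *: "i < j" "j < k" "k < l" "l < length (map ((-) c) xs)"
  then have "i < length xs" "j < length xs" "k < length xs" "l < length xs"
    by auto
  then show "\<not> (map ((-) c) xs ! j < map ((-) c) xs ! l \<and> map ((-) c) xs ! l < map ((-) c) xs ! i
       \<and> map ((-) c) xs ! i < map ((-) c) xs ! k) \<and>
     \<not> (map ((-) c) xs ! k < map ((-) c) xs ! i \<and> map ((-) c) xs ! i < map ((-) c) xs ! l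
       \<and> map ((-) c) xs ! l < map ((-) c) xs ! j)"
    using order_separableD[OF assms *(1-3)] by auto
qed

definition sum_cut :: "int list \<Rightarrow> nat \<Rightarrow> bool" where
  "sum_cut xs k \<longleftrightarrow> 0 < k \<and> k < length xs \<and> (\<forall>i<k. \<forall>j\<in>{k..<length xs}. xs ! i < xs ! j)"

definition skew_cut :: "int list \<Rightarrow> nat \<Rightarrow> bool" where
  "skew_cut xs k \<longleftrightarrow> 0 < k \<and> k < length xs \<and> (\<forall>i<k. \<forall>j\<in>{k..<length xs}. xs ! j < xs ! i)"

lemma sum_cut_diff: "sum_cut (map ((-) c) xs) k \<longleftrightarrow> skew_cut xs k"
  by (auto simp: sum_cut_def skew_cut_def)

lemma skew_cut_diff: "skew_cut (map ((-) c) xs) k \<longleftrightarrow> sum_cut xs k"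
  by (auto simp: sum_cut_def skew_cut_def)

(* a letter strictly inside the value range of the first sum component splits it, or else a 3142 occurs. *)
lemma cut_snoc:
  assumes "distinct (ys @ [c])" "order_separable (ys @ [c])" "sum_cut ys k0"
  shows "\<exists>k. sum_cut (ys @ [c]) k \<or> skew_cut (ys @ [c]) k"
proof (rule ccontr)
  assume no: "\<nexists>k. sum_cut (ys @ [c]) k \<or> skew_cut (ys @ [c]) k"
  define k where "k = (LEAST k. sum_cut ys k)"
  have k: "sum_cut ys k" and least: "\<And>j. sum_cut ys j \<Longrightarrow> k \<le> j"
    unfolding k_def by (rule LeastI[of _ k0], fact) (rule Least_le)
  then have k': "0 < k" "k < length ys" "\<And>i j. i < k \<Longrightarrow> k \<le> j \<Longrightarrow> j < length ys \<Longrightarrow> ys ! i < ys ! j"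
    by (auto simp: sum_cut_def)
  have neq: "ys ! i \<noteq> c" if "i < length ys" for i
    using assms(1) that by (auto simp: in_set_conv_nth)
  \<comment> \<open>Otherwise \<open>c\<close> joins the upper part and the cut at \<open>k\<close>
    survives.\<close>
  have "\<exists>i<k. c < ys ! i"
  proof (rule ccontr)
    assume "\<not> ?thesis"
    then have "ys ! i < c" if "i < k" for i
      using neq[of i] that k' by fastforce
    then have "sum_cut (ys @ [c]) k"
      using k' by (auto simp: sum_cut_def nth_append less_Suc_eq)
    then show False using no by blast
  qed
  then obtain m0 where m0: "m0 < k" "c < ys ! m0"
    by blast
  define m where "m = (LEAST i. c < ys ! i)"
  have m: "c < ys ! m" "m < k" and before: "\<And>i. i < m \<Longrightarrow> \<not> c < ys ! i"
    using m0 unfolding m_def by (auto intro: LeastI le_less_trans[OF Least_le] dest: not_less_Least)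
  \<comment> \<open>Otherwise \<open>c\<close> alone is the lower part of a skew cut. A letter below
    \<open>c\<close> is what makes \<open>m\<close> positive, so that \<open>m\<close> can be a
    cut.\<close>
  have "\<exists>i<length ys. ys ! i < c"
  proof (rule ccontr)
    assume "\<not> ?thesis"
    then have "c < ys ! i" if "i < length ys" for i
      using neq[of i] that by fastforce
    then have "skew_cut (ys @ [c]) (length ys)"
      using k' by (auto simp: skew_cut_def nth_append)
    then show False using no by blast
  qed
  then obtain j where j: "j < length ys" "ys ! j < c"
    by blast
  have high: "c < ys ! i" if "m \<le> i" "i < length ys" for i
  proof (cases "i < k")
    case True
    show ?thesis
    proof (rule ccontr)
      assume "\<not> ?thesis"
      then have "ys ! i < c" "m < i"
        using neq[of i] that m by (auto simp: order.order_iff_strict)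
      moreover have "ys ! m < ys ! k"
        using k' m by simp
      \<comment> \<open>The letters at \<open>m\<close>, \<open>i\<close>, \<open>k\<close> followed
        by \<open>c\<close> are in the order 3142.\<close>
      ultimately show False
        using order_separableD(1)[OF assms(2), of m i k "length ys"] True k'(1,2) m(1)
        by (auto simp: nth_append)
    qed
  next
    case False
    then show ?thesis
      using k'(3)[of m i] m that by simp
  qed
  have "j < m"
    using high[of j] j by (meson not_less less_asym)
  have low: "ys ! i < c" if "i < m" for i
    using before[OF that] neq[of i] that m(2) k'(2) by simp
  \<comment> \<open>All letters before \<open>m\<close> lie below \<open>c\<close> and all others
    above it, which gives a cut earlier than the least one.\<close>
  have "sum_cut ys m"
    unfolding sum_cut_def
  proof (intro conjI allI ballI impI)
    show "ys ! i < ys ! q" if "i < m" "q \<in> {m..<length ys}" for i q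
      using low[of i] high[of q] that by simp
  qed (use \<open>j < m\<close> m(2) k'(2) in auto)
  then show False
    using least[of m] m by simp
qed

lemma order_separable_prefix: "order_separable (xs @ ys) \<Longrightarrow> order_separable xs"
  by (rule order_separable_embed[of "xs @ ys" _ id]) (auto simp: nth_append)

text \<open>Induction on the last letter: a cut of the prefix gives one of the whole word by
  \<open>cut_snoc\<close>, and negating all letters reduces a skew cut of the prefix to a sum
  cut.\<close>

lemma order_separable_cut:
  assumes "distinct xs" "order_separable xs" "2 \<le> length xs"
  shows "\<exists>k. sum_cut xs k \<or> skew_cut xs k"
  using assms
proof (induction xs rule: rev_induct)
  case (snoc c ys)
  show ?case
  proof (cases "length ys = 1")
    case True
    then obtain b where "ys = [b]"
      by (cases ys) auto
    then show ?thesis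
      using snoc.prems by (auto intro!: exI[of _ "1 :: nat"] simp: sum_cut_def skew_cut_def)
  next
    case False
    then obtain k where "sum_cut ys k \<or> skew_cut ys k"
      using snoc order_separable_prefix by force
    then show ?thesis
    proof
      assume "sum_cut ys k"
      then show ?thesis
        using cut_snoc snoc.prems by blast
    next
      assume "skew_cut ys k"
      then have "sum_cut (map ((-) 0) ys) k"
        by (simp only: sum_cut_diff)
      then have "\<exists>k. sum_cut (map ((-) 0) ys @ [0 - c]) k \<or> skew_cut (map ((-) 0) ys @ [0 - c]) k"
        using snoc.prems order_separable_diff[of "ys @ [c]" 0]
        by (intro cut_snoc) (auto simp: distinct_map inj_on_def)
      then show ?thesis
        using sum_cut_diff[of 0 "ys @ [c]"] skew_cut_diff[of 0 "ys @ [c]"] by auto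
    qed
  qed
qed simp

text \<open>Any cut separates the first letter from the last, so its kind is determined by how these
  two compare.\<close>

lemma sum_skew_cut_disjoint:
  assumes "sum_cut xs k" "skew_cut xs l"
  shows False
proof -
  let ?n = "length xs - 1"
  have "0 < k" "k \<le> ?n" "?n < length xs" "0 < l" "l \<le> ?n"
    using assms by (auto simp: sum_cut_def skew_cut_def)
  then have "xs ! 0 < xs ! ?n" "xs ! ?n < xs ! 0"
    using assms by (auto simp: sum_cut_def skew_cut_def)
  then show False by simp
qed

text \<open>The flags tell whether the left and the right neighbour are larger:
  \<open>X True True\<close> weighs a valley, \<open>X False True\<close> a double ascent,
  \<open>X True False\<close> a double descent and \<open>X False False\<close> a peak. The
  arguments \<open>l\<close> and \<open>r\<close> are the flags at the two ends, \<open>True\<close>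
  corresponding to infinity.\<close>

fun word_weight :: "(bool \<Rightarrow> bool \<Rightarrow> 'a) \<Rightarrow> bool \<Rightarrow> bool \<Rightarrow> int list \<Rightarrow> 'a::comm_monoid_mult" where
  "word_weight X l r [] = 1"
| "word_weight X l r [x] = X l r"
| "word_weight X l r (x # y # zs) = X l (x < y) * word_weight X (y < x) r (y # zs)"

lemma wt_append:
  assumes "u \<noteq> []" "v \<noteq> []"
  shows "word_weight X l r (u @ v) = word_weight X l (last u < hd v) u * word_weight X (hd v < last u) r v"
  using assms
proof (induction X l r u rule: word_weight.induct)
  case (2 X l r x)
  then show ?case by (cases v) auto
qed (auto simp: mult.assoc)

lemma wt_shift: "word_weight X l r (map (\<lambda>x. x + c) xs) = word_weight X l r xs"
  by (induction X l r xs rule: word_weight.induct) auto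

lemma wt_diff:
  "distinct xs \<Longrightarrow> word_weight X l r (map ((-) c) xs) = word_weight (\<lambda>l r. X (\<not> l) (\<not> r)) (\<not> l) (\<not> r) xs"
proof (induction xs arbitrary: l r rule: induct_list012)
  case (3 x y zs)
  have "x < y \<longleftrightarrow> \<not> y < x"
    using 3 by auto
  then show ?case
    using 3 by simp
qed auto

section \<open>Direct sums of separable permutations\<close>

definition separable_words :: "nat \<Rightarrow> int list set" where
  "separable_words n = {xs. length xs = n \<and> set xs = {1..int n} \<and> order_separable xs}"

definition sum_indec :: "nat \<Rightarrow> int list set" where
  "sum_indec n = {xs \<in> separable_words n. \<nexists>k. sum_cut xs k}"

definition skew_indec :: "nat \<Rightarrow> int list set" where
  "skew_indec n = {xs \<in> separable_words n. \<nexists>k. skew_cut xs k}"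

definition dsum :: "int list \<Rightarrow> int list \<Rightarrow> int list" where
  "dsum u v = u @ map (\<lambda>x. x + int (length u)) v"

lemma sep_distinct: "xs \<in> separable_words n \<Longrightarrow> distinct xs"
  by (auto simp: separable_words_def intro!: card_distinct)

lemma finite_sep: "finite (separable_words n)"
  by (rule finite_subset[OF _ finite_lists_length_eq[of "{1..int n}" n]]) (auto simp: separable_words_def)

lemma finite_sum_indec: "finite (sum_indec n)"
  by (simp add: sum_indec_def finite_sep)

text \<open>The patterns 3142 and 2413 are themselves sum indecomposable, so no occurrence can
  straddle the two blocks.\<close>

lemma order_separable_append:
  assumes "order_separable u" "order_separable v" "\<And>x y. x \<in> set u \<Longrightarrow> y \<in> set v \<Longrightarrow> x < y"
  shows "order_separable (u @ v)"
  unfolding order_separable_def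
proof (intro allI impI)
  fix i j k l assume *: "i < j" "j < k" "k < l" "l < length (u @ v)"
  let ?w = "u @ v" and ?m = "length u"
  have u: "?w ! p = u ! p" if "p < ?m" for p
    using that by (simp add: nth_append)
  have v: "?w ! p = v ! (p - ?m)" if "\<not> p < ?m" for p
    using that by (simp add: nth_append)
  have less: "?w ! p < ?w ! q" if "p < ?m" "?m \<le> q" "q < length ?w" for p q
    using that assms(3) by (auto simp: nth_append)
  consider "l < ?m" | "?m \<le> i" | "i < ?m" "?m \<le> l"
    by linarith
  then show "\<not> (?w ! j < ?w ! l \<and> ?w ! l < ?w ! i \<and> ?w ! i < ?w ! k) \<and>
     \<not> (?w ! k < ?w ! i \<and> ?w ! i < ?w ! l \<and> ?w ! l < ?w ! j)"
  proof cases
    case 1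
    then show ?thesis
      using order_separableD[OF assms(1) *(1-3)] * by (simp add: u)
  next
    case 2
    then show ?thesis
      using order_separableD[OF assms(2), of "i - ?m" "j - ?m" "k - ?m" "l - ?m"] * by (simp add: v)
  next
    case 3
    then show ?thesis
      using less[of i l] less[of i k] less[of j l] less[of k l] less[of j k] * by linarith
  qed
qed

lemma dsum_sep:
  assumes "u \<in> separable_words k" "v \<in> separable_words m"
  shows "dsum u v \<in> separable_words (k + m)"
proof -
  have "(\<lambda>x. x + int k) ` {1..int m} = {int k + 1..int k + int m}"
    by (simp add: add.commute)
  then have set: "set (dsum u v) = {1..int (k + m)}"
    using assms by (auto simp: dsum_def separable_words_def)
  have "order_separable (map (\<lambda>x. x + int k) v)"
    by (rule order_separable_embed[of v _ id]) (use assms(2) in \<open>auto simp: separable_words_def\<close>)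
  then have "order_separable (dsum u v)"
    unfolding dsum_def using assms
    by (intro order_separable_append) (auto simp: separable_words_def)
  with set assms show ?thesis
    by (simp add: separable_words_def dsum_def)
qed

text \<open>Makes the first component at the least cut indecomposable, and conversely makes a cut
  after an indecomposable first component the least one.\<close>

lemma sum_cut_take:
  assumes "sum_cut xs k"
  shows "sum_cut (take k xs) j \<longleftrightarrow> sum_cut xs j \<and> j < k"
proof
  assume *: "sum_cut (take k xs) j"
  then have j: "0 < j" "j < k"
    by (auto simp: sum_cut_def)
  have "xs ! p < xs ! q" if "p < j" "q \<in> {j..<length xs}" for p q
    using assms * that by (cases "q < k") (auto simp: sum_cut_def)
  then show "sum_cut xs j \<and> j < k"
    using j assms by (auto simp: sum_cut_def)
qed (auto simp: sum_cut_def)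

lemma sum_cut_dsum:
  assumes "u \<in> separable_words k" "v \<in> separable_words m" "0 < k" "0 < m"
  shows "sum_cut (dsum u v) k"
proof -
  have u: "u ! i \<le> int k" if "i < k" for i
    using assms(1) that nth_mem[of i u] by (auto simp: separable_words_def)
  have v: "1 \<le> v ! i" if "i < m" for i
    using assms(2) that nth_mem[of i v] by (auto simp: separable_words_def)
  have "u ! i < v ! (j - k) + int k" if "i < k" "k \<le> j" "j < k + m" for i j
    using that u[of i] v[of "j - k"] by linarith
  then show ?thesis
    using assms by (auto simp: sum_cut_def dsum_def nth_append separable_words_def)
qed

text \<open>Identifies the letters of a first component of length k as 1, ..., k, so that it needs
  no standardization.\<close>

lemma initial_segment_of_interval:
  fixes A B :: "int set"
  assumes "A \<union> B = {1..n}" "\<And>x y. x \<in> A \<Longrightarrow> y \<in> B \<Longrightarrow> x < y"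
  shows "A = {1..int (card A)}"
proof -
  have fin: "finite A"
    using assms(1) by (metis finite_Un finite_atLeastAtMost_int)
  show ?thesis
  proof (cases "A = {}")
    case False
    have "A = {1..Max A}"
    proof (intro equalityI subsetI)
      fix x assume "x \<in> A"
      then show "x \<in> {1..Max A}"
        using assms(1) fin by auto
    next
      fix x assume x: "x \<in> {1..Max A}"
      have "Max A \<in> A"
        using fin False by simp
      then have "Max A \<le> n" "1 \<le> Max A"
        using assms(1) by auto
      then have "x \<in> A \<union> B"
        using x assms(1) by simp
      moreover have "x \<notin> B"
        using assms(2)[of "Max A" x] x \<open>Max A \<in> A\<close> by auto
      ultimately show "x \<in> A"
        by simp
    qed
    moreover have "1 \<le> Max A"
      using calculation False by fastforce
    then have "int (card {1..Max A}) = Max A"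
      by simp
    ultimately show ?thesis
      by metis
  qed simp
qed

lemma sum_cut_split:
  assumes "xs \<in> separable_words n" "sum_cut xs k"
  shows "take k xs \<in> separable_words k" "map (\<lambda>x. x - int k) (drop k xs) \<in> separable_words (n - k)"
    "dsum (take k xs) (map (\<lambda>x. x - int k) (drop k xs)) = xs"
proof -
  have k: "k < n" "length xs = n"
    using assms by (auto simp: sum_cut_def separable_words_def)
  have sep: "order_separable xs"
    using assms by (simp add: separable_words_def)
  have dist: "distinct xs"
    using assms sep_distinct by blast
  have un: "set (take k xs) \<union> set (drop k xs) = {1..int n}"
    using assms(1) by (metis (mono_tags, lifting) append_take_drop_id mem_Collect_eq separable_words_def set_append)
  have less: "x < y" if "x \<in> set (take k xs)" "y \<in> set (drop k xs)" for x y
    using that assms(2) k by (fastforce simp: sum_cut_def in_set_conv_nth)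
  have "card (set (take k xs)) = k"
    using distinct_card[OF distinct_take[OF dist, of k]] k by simp
  then have set: "set (take k xs) = {1..int k}"
    using initial_segment_of_interval[OF un less] by simp
  have "set (take k xs) \<inter> set (drop k xs) = {}"
    using less by fastforce
  then have "set (drop k xs) = {1..int n} - {1..int k}"
    using un set by auto
  also have "\<dots> = {int k + 1..int n}"
    by auto
  finally have "set (drop k xs) = {int k + 1..int n}" .
  then have "(\<lambda>x. x - int k) ` set (drop k xs) = {1..int (n - k)}"
    using k by (simp add: image_diff_atLeastAtMost of_nat_diff)
  moreover have "order_separable (take k xs)"
    by (rule order_separable_embed[of xs _ id]) (use sep in auto)
  moreover have "order_separable (map (\<lambda>x. x - int k) (drop k xs))"
    by (rule order_separable_embed[of xs _ "\<lambda>i. i + k"]) (use sep in \<open>auto simp: add.commute\<close>)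
  ultimately show "take k xs \<in> separable_words k" "map (\<lambda>x. x - int k) (drop k xs) \<in> separable_words (n - k)"
    using set k by (auto simp: separable_words_def)
  show "dsum (take k xs) (map (\<lambda>x. x - int k) (drop k xs)) = xs"
    using k by (simp add: dsum_def comp_def)
qed

lemma dsum_inject:
  assumes "length u = length u'"
  shows "dsum u v = dsum u' v' \<longleftrightarrow> u = u' \<and> v = v'"
proof -
  have "inj (\<lambda>x. x + int (length u'))"
    by (simp add: inj_def)
  then show ?thesis
    using assms by (auto simp: dsum_def inj_map_eq_map)
qed

(* cutting at the least position makes the first component indecomposable and the cut unique. *)
lemma bij_betw_dsum:
  "bij_betw (\<lambda>(k, u, v). dsum u v) (SIGMA k:{1..<n}. sum_indec k \<times> separable_words (n - k))
     {xs \<in> separable_words n. \<exists>k. sum_cut xs k}" (is "bij_betw ?f ?A ?B")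
proof (rule bij_betw_imageI)
  have least: "(LEAST j. sum_cut (dsum u v) j) = k"
    if "k \<in> {1..<n}" "u \<in> sum_indec k" "v \<in> separable_words (n - k)" for k u v
  proof (rule Least_equality)
    have len: "length u = k"
      using that by (simp add: sum_indec_def separable_words_def)
    show cut: "sum_cut (dsum u v) k"
      using that by (intro sum_cut_dsum[of _ _ _ "n - k"]) (auto simp: sum_indec_def)
    show "k \<le> j" if "sum_cut (dsum u v) j" for j
      using sum_cut_take[OF cut, of j] that \<open>u \<in> sum_indec k\<close> len
      by (auto simp: sum_indec_def dsum_def not_less)
  qed
  show "inj_on ?f ?A"
  proof (rule inj_onI)
    fix s t assume st: "s \<in> ?A" "t \<in> ?A" "?f s = ?f t"
    obtain k u v k' u' v' where "s = (k, u, v)" "t = (k', u', v')"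
      by (metis surj_pair)
    moreover from this have "k = k'"
      using st least[of k u v] least[of k' u' v'] by auto
    ultimately show "s = t"
      using st by (auto simp: sum_indec_def separable_words_def dsum_inject)
  qed
  show "?f ` ?A = ?B"
  proof (intro equalityI subsetI)
    fix xs assume "xs \<in> ?f ` ?A"
    then obtain k u v where *: "k \<in> {1..<n}" "u \<in> separable_words k" "v \<in> separable_words (n - k)" "xs = dsum u v"
      by (auto simp: sum_indec_def)
    then show "xs \<in> ?B"
      using dsum_sep[of u k v "n - k"] sum_cut_dsum[of u k v "n - k"] by auto
  next
    fix xs assume "xs \<in> ?B"
    then have xs: "xs \<in> separable_words n" "\<exists>k. sum_cut xs k"
      by auto
    define k where "k = (LEAST k. sum_cut xs k)"
    have k: "sum_cut xs k"
      unfolding k_def using xs(2) by (rule LeastI_ex)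
    have "\<not> sum_cut (take k xs) j" for j
      using sum_cut_take[OF k, of j] not_less_Least[of j "sum_cut xs"] by (auto simp: k_def)
    then have "take k xs \<in> sum_indec k"
      using sum_cut_split(1)[OF xs(1) k] by (simp add: sum_indec_def)
    moreover have "k \<in> {1..<n}"
      using k xs(1) by (auto simp: sum_cut_def separable_words_def)
    ultimately show "xs \<in> ?f ` ?A"
      using sum_cut_split(2,3)[OF xs(1) k]
      by (intro image_eqI[of _ _ "(k, take k xs, map (\<lambda>x. x - int k) (drop k xs))"]) auto
  qed
qed

text \<open>At the junction the last letter of \<open>u\<close> sees a larger letter to its right,
  and the first letter of \<open>v\<close> a smaller one to its left; these are the inner flags
  \<open>True\<close> and \<open>False\<close>.\<close>

lemma wt_dsum:
  assumes "u \<in> separable_words k" "v \<in> separable_words m" "0 < k" "0 < m"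
  shows "word_weight X l r (dsum u v) = word_weight X l True u * word_weight X False r v"
proof -
  let ?v = "map (\<lambda>x. x + int (length u)) v"
  have ne: "u \<noteq> []" "v \<noteq> []"
    using assms by (auto simp: separable_words_def)
  then have "last u \<in> {1..int k}" "hd v \<in> {1..int m}" "length u = k"
    using assms last_in_set[of u] hd_in_set[of v] by (auto simp: separable_words_def)
  then have "last u < hd ?v"
    using ne by (simp add: hd_map)
  then show ?thesis
    unfolding dsum_def using ne by (simp add: wt_append wt_shift not_less_iff_gr_or_eq)
qed

section \<open>Weighted sums and generating functions of separable permutations\<close>

definition sep_sum :: "(bool \<Rightarrow> bool \<Rightarrow> 'a::comm_ring_1) \<Rightarrow> bool \<Rightarrow> bool \<Rightarrow> nat \<Rightarrow> 'a" where
  "sep_sum X l r n = (\<Sum>xs\<in>separable_words n. word_weight X l r xs)"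

definition sum_indec_sum :: "(bool \<Rightarrow> bool \<Rightarrow> 'a::comm_ring_1) \<Rightarrow> bool \<Rightarrow> bool \<Rightarrow> nat \<Rightarrow> 'a" where
  "sum_indec_sum X l r n = (\<Sum>xs\<in>sum_indec n. word_weight X l r xs)"

definition skew_indec_sum :: "(bool \<Rightarrow> bool \<Rightarrow> 'a::comm_ring_1) \<Rightarrow> bool \<Rightarrow> bool \<Rightarrow> nat \<Rightarrow> 'a" where
  "skew_indec_sum X l r n = (\<Sum>xs\<in>skew_indec n. word_weight X l r xs)"

lemma sep_sum_decomposition:
  "sep_sum X l r n = sum_indec_sum X l r n
     + (\<Sum>k\<in>{1..<n}. sum_indec_sum X l True k * sep_sum X False r (n - k))"
proof -
  have split: "separable_words n = sum_indec n \<union> {xs \<in> separable_words n. \<exists>k. sum_cut xs k}"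
    by (auto simp: sum_indec_def)
  have "sep_sum X l r n = sum_indec_sum X l r n + (\<Sum>xs | xs \<in> separable_words n \<and> (\<exists>k. sum_cut xs k). word_weight X l r xs)"
    unfolding sep_sum_def sum_indec_sum_def
    by (subst split, rule sum.union_disjoint) (auto simp: finite_sum_indec finite_sep sum_indec_def)
  also have "(\<Sum>xs | xs \<in> separable_words n \<and> (\<exists>k. sum_cut xs k). word_weight X l r xs) =
      (\<Sum>(k, u, v)\<in>(SIGMA k:{1..<n}. sum_indec k \<times> separable_words (n - k)). word_weight X l r (dsum u v))"
    by (subst sum.reindex_bij_betw[OF bij_betw_dsum, symmetric]) (simp add: case_prod_unfold)
  also have "\<dots> = (\<Sum>k\<in>{1..<n}. \<Sum>(u, v)\<in>sum_indec k \<times> separable_words (n - k). word_weight X l r (dsum u v))"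
    by (subst sum.Sigma) (auto simp: finite_sum_indec finite_sep)
  also have "\<dots> = (\<Sum>k\<in>{1..<n}. \<Sum>(u, v)\<in>sum_indec k \<times> separable_words (n - k). word_weight X l True u * word_weight X False r v)"
    by (intro sum.cong refl) (auto simp: sum_indec_def intro!: wt_dsum)
  also have "\<dots> = (\<Sum>k\<in>{1..<n}. sum_indec_sum X l True k * sep_sum X False r (n - k))"
    by (simp add: sep_sum_def sum_indec_sum_def sum_product sum.cartesian_product)
  finally show ?thesis .
qed

lemma bij_betw_complement: "bij_betw (map ((-) (int n + 1))) (separable_words n) (separable_words n)"
proof -
  let ?c = "map ((-) (int n + 1))"
  have inv: "?c (?c xs) = xs" for xs
    by (induction xs) auto
  have "?c xs \<in> separable_words n" if "xs \<in> separable_words n" for xs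
  proof -
    have "set (?c xs) = (-) (int n + 1) ` {1..int n}"
      using that by (simp add: separable_words_def)
    also have "\<dots> = {1..int n}"
      by (simp add: image_diff_atLeastAtMost)
    finally show ?thesis
      using that order_separable_diff by (simp add: separable_words_def)
  qed
  then show ?thesis
    by (intro bij_betwI[of _ _ _ ?c]) (auto simp: inv simp del: map_map)
qed

lemma sep_sum_complement:
  "sep_sum X l r n = sep_sum (\<lambda>l r. X (\<not> l) (\<not> r)) (\<not> l) (\<not> r) n"
  unfolding sep_sum_def
proof -
  have "(\<Sum>xs\<in>separable_words n. word_weight X l r xs) = (\<Sum>xs\<in>separable_words n. word_weight X l r (map ((-) (int n + 1)) xs))"
    by (rule sum.reindex_bij_betw[OF bij_betw_complement, symmetric])
  also have "\<dots> = (\<Sum>xs\<in>separable_words n. word_weight (\<lambda>l r. X (\<not> l) (\<not> r)) (\<not> l) (\<not> r) xs)"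
    by (intro sum.cong refl) (simp add: wt_diff sep_distinct)
  finally show "(\<Sum>xs\<in>separable_words n. word_weight X l r xs) = (\<Sum>xs\<in>separable_words n. word_weight (\<lambda>l r. X (\<not> l) (\<not> r)) (\<not> l) (\<not> r) xs)" .
qed

lemma skew_indec_sum_complement:
  "skew_indec_sum X l r n = sum_indec_sum (\<lambda>l r. X (\<not> l) (\<not> r)) (\<not> l) (\<not> r) n"
proof -
  have "bij_betw (map ((-) (int n + 1))) {xs \<in> separable_words n. \<nexists>k. sum_cut xs k} {xs \<in> separable_words n. \<nexists>k. skew_cut xs k}"
    by (intro bij_betw_Collect[OF bij_betw_complement]) (simp add: skew_cut_diff)
  then have "bij_betw (map ((-) (int n + 1))) (sum_indec n) (skew_indec n)"
    by (simp add: sum_indec_def skew_indec_def)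
  then have "skew_indec_sum X l r n = (\<Sum>xs\<in>sum_indec n. word_weight X l r (map ((-) (int n + 1)) xs))"
    unfolding skew_indec_sum_def by (rule sum.reindex_bij_betw[symmetric])
  also have "\<dots> = sum_indec_sum (\<lambda>l r. X (\<not> l) (\<not> r)) (\<not> l) (\<not> r) n"
    unfolding sum_indec_sum_def
    by (intro sum.cong refl wt_diff) (auto simp: sum_indec_def intro: sep_distinct)
  finally show ?thesis .
qed

text \<open>Complementing values exchanges sum and skew cuts and flips every flag, so this is
  \<open>sep_sum_decomposition\<close> for the flipped weight; the junction flags become
  \<open>False\<close> and \<open>True\<close>.\<close>

lemma sep_sum_skew_decomposition:
  "sep_sum X l r n = skew_indec_sum X l r n
     + (\<Sum>k\<in>{1..<n}. skew_indec_sum X l False k * sep_sum X True r (n - k))"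
  unfolding sep_sum_complement[of X] skew_indec_sum_complement[of X]
  using sep_sum_decomposition[of "\<lambda>l r. X (\<not> l) (\<not> r)" "\<not> l" "\<not> r" n] by simp

lemma sep_1: "separable_words 1 = {[1]}"
proof -
  have "order_separable [1]"
    by (simp add: order_separable_def)
  moreover have "length xs = 1 \<and> set xs = {1} \<longleftrightarrow> xs = [1]" for xs :: "int list"
    by (cases xs) auto
  ultimately show ?thesis
    unfolding separable_words_def by auto
qed

text \<open>From length 2 on, a separable word has cuts of exactly one kind, hence is indecomposable
  in exactly one sense. The one-letter word is counted on the right twice, hence the
  correction.\<close>

lemma sep_sum_indec:
  assumes "0 < n"
  shows "sep_sum X l r n + (if n = 1 then X l r else 0) = sum_indec_sum X l r n + skew_indec_sum X l r n"
proof (cases "n = 1")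
  case True
  have "sum_indec 1 = {[1]}" "skew_indec 1 = {[1]}"
    unfolding sum_indec_def skew_indec_def sep_1 by (auto simp: sum_cut_def skew_cut_def)
  then show ?thesis
    using True by (simp add: sep_sum_def sum_indec_sum_def skew_indec_sum_def sep_1[simplified])
next
  case False
  then have "\<exists>k. sum_cut xs k \<or> skew_cut xs k" if "xs \<in> separable_words n" for xs
    using that assms order_separable_cut[of xs] sep_distinct[of xs n] by (auto simp: separable_words_def)
  then have "separable_words n \<subseteq> sum_indec n \<union> skew_indec n - sum_indec n \<inter> skew_indec n"
    using sum_skew_cut_disjoint unfolding sum_indec_def skew_indec_def by blast
  then have "separable_words n = sum_indec n \<union> skew_indec n" "sum_indec n \<inter> skew_indec n = {}"
    by (auto simp: sum_indec_def skew_indec_def)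
  then show ?thesis
    using False finite_sep[of n] unfolding sep_sum_def sum_indec_sum_def skew_indec_sum_def
    by (simp add: sum.union_disjoint)
qed

text \<open>The empty word is left out: components are nonempty, and the zero constant term is
  needed for uniqueness in the cubic.\<close>

definition sep_fps :: "(bool \<Rightarrow> bool \<Rightarrow> 'a::comm_ring_1) \<Rightarrow> bool \<Rightarrow> bool \<Rightarrow> 'a fps" where
  "sep_fps X l r = Abs_fps (\<lambda>n. if n = 0 then 0 else sep_sum X l r n)"

lemma fps_convolution_nth:
  fixes f g :: "nat \<Rightarrow> 'a::comm_ring_1"
  shows "fps_nth (Abs_fps (\<lambda>n. if n = 0 then 0 else f n) * Abs_fps (\<lambda>n. if n = 0 then 0 else g n)) n
    = (\<Sum>k\<in>{1..<n}. f k * g (n - k))"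
  unfolding fps_mult_nth
  by (rule sum.mono_neutral_cong_right) auto

lemma sep_fps_cubic:
  fixes X :: "bool \<Rightarrow> bool \<Rightarrow> 'a::idom"
  assumes "X True True = 1"
  shows "sep_fps X True True = fps_X * (1 + fps_const (X False True + X True False) * sep_fps X True True
             + fps_const (X False False) * sep_fps X True True ^ 2)
           + fps_const (X False False) * sep_fps X True True ^ 3"
proof (rule decomposition_system_cubic
    [where S = "sep_fps X" and X = X and I = "\<lambda>l r. Abs_fps (\<lambda>n. if n = 0 then 0 else sum_indec_sum X l r n)"
       and J = "\<lambda>l r. Abs_fps (\<lambda>n. if n = 0 then 0 else skew_indec_sum X l r n)"])
  show "sep_fps X l r = Abs_fps (\<lambda>n. if n = 0 then 0 else sum_indec_sum X l r n)
      + Abs_fps (\<lambda>n. if n = 0 then 0 else sum_indec_sum X l True n) * sep_fps X False r" for l r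
    unfolding sep_fps_def
    by (rule fps_ext) (simp add: fps_convolution_nth sep_sum_decomposition[of X l r])
  show "sep_fps X l r = Abs_fps (\<lambda>n. if n = 0 then 0 else skew_indec_sum X l r n)
      + Abs_fps (\<lambda>n. if n = 0 then 0 else skew_indec_sum X l False n) * sep_fps X True r" for l r
    unfolding sep_fps_def
    by (rule fps_ext) (simp add: fps_convolution_nth sep_sum_skew_decomposition[of X l r])
  show "sep_fps X l r + fps_const (X l r) * fps_X =
      Abs_fps (\<lambda>n. if n = 0 then 0 else sum_indec_sum X l r n)
      + Abs_fps (\<lambda>n. if n = 0 then 0 else skew_indec_sum X l r n)" for l r
  proof (rule fps_ext)
    fix n
    show "fps_nth (sep_fps X l r + fps_const (X l r) * fps_X) n =
        fps_nth (Abs_fps (\<lambda>n. if n = 0 then 0 else sum_indec_sum X l r n)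
          + Abs_fps (\<lambda>n. if n = 0 then 0 else skew_indec_sum X l r n)) n"
      using sep_sum_indec[of n X l r] by (auto simp: sep_fps_def)
  qed
qed (simp_all add: sep_fps_def assms)

(* The cubic only sees the sum of the weights of double ascents and double descents. *)
lemma sep_sum_eq:
  fixes X Y :: "bool \<Rightarrow> bool \<Rightarrow> 'a::idom"
  assumes "X True True = 1" "Y True True = 1" "X False False = Y False False"
    "X False True + X True False = Y False True + Y True False" "0 < n"
  shows "sep_sum X True True n = sep_sum Y True True n"
proof -
  have "sep_fps X True True = sep_fps Y True True"
  proof (rule cubic_fps_unique)
    show "sep_fps Y True True = fps_X * (1 + fps_const (X False True + X True False) * sep_fps Y True True
        + fps_const (X False False) * sep_fps Y True True ^ 2)
      + fps_const (X False False) * sep_fps Y True True ^ 3"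
      unfolding assms(3,4) by (rule sep_fps_cubic[of Y, OF assms(2)])
  qed (rule sep_fps_cubic[of X, OF assms(1)], simp_all add: sep_fps_def)
  then have "fps_nth (sep_fps X True True) n = fps_nth (sep_fps Y True True) n"
    by simp
  then show ?thesis
    using assms(5) by (simp add: sep_fps_def)
qed

section \<open>Descents, double descents and the two specializations of the weight\<close>

fun word_des :: "int list \<Rightarrow> nat" where
  "word_des (x # y # zs) = of_bool (y < x) + word_des (y # zs)"
| "word_des _ = 0"

text \<open>\<open>l\<close> is the left flag of the first letter. The last letter never counts, as
  infinity follows it.\<close>

fun word_dd :: "bool \<Rightarrow> int list \<Rightarrow> nat" where
  "word_dd l (x # y # zs) = of_bool (l \<and> y < x) + word_dd (y < x) (y # zs)"
| "word_dd l _ = 0"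

definition eulerian_weight :: "bool \<Rightarrow> bool \<Rightarrow> int poly" where
  "eulerian_weight l r = (if r then 1 else [:0, 1:])"

definition gamma_weight :: "bool \<Rightarrow> bool \<Rightarrow> int poly" where
  "gamma_weight l r = (if l then if r then 1 else 0 else if r then [:1, 1:] else [:0, 1:])"

lemma gamma_weight_simps [simp]:
  "gamma_weight True True = 1" "gamma_weight True False = 0"
  "gamma_weight False True = [:1, 1:]" "gamma_weight False False = [:0, 1:]"
  by (simp_all add: gamma_weight_def)

lemma wt_eulerian:
  assumes "distinct xs"
  shows "word_weight eulerian_weight l True xs = monom 1 (word_des xs)"
  using assms
proof (induction xs arbitrary: l rule: induct_list012)
  case (3 x y zs)
  have "x < y \<longleftrightarrow> \<not> y < x"
    using 3 by auto
  then show ?case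
    using 3 by (simp add: eulerian_weight_def monom_Suc)
qed (auto simp: eulerian_weight_def)

text \<open>A double descent has weight 0. Without double descents the descents are exactly the
  peaks, and peaks and valleys alternate, with one more valley than peaks if \<open>l\<close> holds
  and equally many otherwise; the remaining letters are double ascents, whose number is the exponent
  of 1 + t. The inequality is carried along so that the subtraction in this exponent is not
  truncated.\<close>

lemma wt_gamma:
  assumes "distinct xs" "xs \<noteq> []"
  shows "(word_dd l xs = 0 \<longrightarrow> 2 * word_des xs + of_bool l \<le> length xs) \<and> word_weight gamma_weight l True xs =
    (if word_dd l xs = 0 then monom 1 (word_des xs) * [:1, 1:] ^ (length xs - of_bool l - 2 * word_des xs) else 0)"
  using assms
proof (induction xs arbitrary: l rule: induct_list012)
  case (3 x y zs)
  have xy: "x < y \<longleftrightarrow> \<not> y < x"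
    using 3 by auto
  have IH: "(word_dd b (y # zs) = 0 \<longrightarrow> 2 * word_des (y # zs) + of_bool b \<le> length (y # zs))"
    "word_weight gamma_weight b True (y # zs) = (if word_dd b (y # zs) = 0 then monom 1 (word_des (y # zs))
       * [:1, 1:] ^ (length (y # zs) - of_bool b - 2 * word_des (y # zs)) else 0)" for b
    using 3(2)[of b] 3(3) by auto
  show ?case
  proof (cases "y < x")
    case True
    then show ?thesis
      using xy IH[of True] by (auto simp: monom_Suc)
  next
    case False
    then show ?thesis
      using xy IH[of False]
      by (auto simp: Suc_diff_le simp del: mult_pCons_left)
  qed
qed auto

lemma sep_gamma_expansion:
  "(\<Sum>xs\<in>separable_words (n + 1). monom (1 :: int) (word_des xs)) =
     gamma_expansion n (\<lambda>k. int (card {xs \<in> separable_words (n + 1). word_dd True xs = 0 \<and> word_des xs = k}))"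
proof -
  have ne: "xs \<noteq> []" "length xs = n + 1" "distinct xs" if "xs \<in> separable_words (n + 1)" for xs
    using that sep_distinct[OF that] by (auto simp: separable_words_def)
  let ?P = "\<lambda>k. monom 1 k * [:1, 1:] ^ (n - 2 * k) :: int poly"
  have "(\<Sum>xs\<in>separable_words (n + 1). monom (1 :: int) (word_des xs)) = sep_sum eulerian_weight True True (n + 1)"
    unfolding sep_sum_def by (intro sum.cong) (simp_all add: wt_eulerian sep_distinct)
  also have "\<dots> = sep_sum gamma_weight True True (n + 1)"
    by (rule sep_sum_eq) (simp_all add: eulerian_weight_def gamma_weight_def one_pCons)
  also have "\<dots> = (\<Sum>xs\<in>separable_words (n + 1). if word_dd True xs = 0 then ?P (word_des xs) else 0)"
    unfolding sep_sum_def by (intro sum.cong refl) (use wt_gamma[of _ True] ne in simp)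
  also have "\<dots> = (\<Sum>xs | xs \<in> separable_words (n + 1) \<and> word_dd True xs = 0. ?P (word_des xs))"
    by (simp add: finite_sep sum.If_cases Int_def)
  also have "\<dots> = (\<Sum>k\<in>{0..n div 2}. \<Sum>xs | xs \<in> {xs \<in> separable_words (n + 1). word_dd True xs = 0} \<and> word_des xs = k. ?P (word_des xs))"
  proof (rule sum.group[symmetric])
    \<comment> \<open>The bound comes from the inequality 2 des + 1 \<le> n + 1 in
      \<open>wt_gamma\<close>.\<close>
    show "word_des ` {xs \<in> separable_words (n + 1). word_dd True xs = 0} \<subseteq> {0..n div 2}"
      using wt_gamma[of _ True] ne by force
  qed (auto simp: finite_sep)
  also have "\<dots> = gamma_expansion n (\<lambda>k. int (card {xs \<in> separable_words (n + 1). word_dd True xs = 0 \<and> word_des xs = k}))"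
    unfolding gamma_expansion_def
    by (intro sum.cong refl) (simp add: conj_assoc of_nat_poly)
  finally show ?thesis .
qed

section \<open>Standardization of signed words\<close>

text \<open>The relation is a parameter because ranks are taken both of letters and of absolute
  values, the latter being known only through \<open>abs_less\<close>. Counting \<open>i\<close>
  itself makes ranks start at 1.\<close>

definition rank :: "nat \<Rightarrow> (nat \<Rightarrow> nat \<Rightarrow> bool) \<Rightarrow> nat \<Rightarrow> int" where
  "rank n lt i = int (card {j. j < n \<and> (j = i \<or> lt j i)})"

definition strict_total :: "nat \<Rightarrow> (nat \<Rightarrow> nat \<Rightarrow> bool) \<Rightarrow> bool" where
  "strict_total n lt \<longleftrightarrow>
     (\<forall>i<n. \<not> lt i i \<and> (\<forall>j<n. (i \<noteq> j \<longrightarrow> lt i j \<or> lt j i) \<and> (\<forall>k<n. lt i j \<longrightarrow> lt j k \<longrightarrow> lt i k)))"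

lemma rank_less_iff:
  assumes "strict_total n lt" "i < n" "j < n"
  shows "rank n lt i < rank n lt j \<longleftrightarrow> lt i j"
proof -
  have less: "rank n lt i < rank n lt j" if "i < n" "j < n" "lt i j" for i j
  proof -
    have "k < n \<and> (k = j \<or> lt k j)" if "k < n \<and> (k = i \<or> lt k i)" for k
      using that assms(1) \<open>i < n\<close> \<open>j < n\<close> \<open>lt i j\<close> unfolding strict_total_def by metis
    moreover have "\<not> (j < n \<and> (j = i \<or> lt j i))"
      using that assms(1) unfolding strict_total_def by metis
    ultimately have "{k. k < n \<and> (k = i \<or> lt k i)} \<subset> {k. k < n \<and> (k = j \<or> lt k j)}"
      using \<open>j < n\<close> by (intro psubsetI) auto
    then show ?thesis
      unfolding rank_def by (simp add: psubset_card_mono)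
  qed
  have "i = j \<or> lt i j \<or> lt j i" "\<not> lt i i"
    using assms unfolding strict_total_def by metis+
  then show ?thesis
    using less[OF assms(2,3)] less[OF assms(3,2)] by (metis less_asym less_irrefl)
qed

lemma rank_image:
  assumes "strict_total n lt"
  shows "rank n lt ` {..<n} = {1..int n}"
proof (rule card_subset_eq)
  have "inj_on (rank n lt) {..<n}"
  proof (rule inj_onI)
    fix i j assume "i \<in> {..<n}" "j \<in> {..<n}" "rank n lt i = rank n lt j"
    moreover from this have "\<not> lt i j" "\<not> lt j i"
      using rank_less_iff[OF assms, of i j] rank_less_iff[OF assms, of j i] by auto
    ultimately show "i = j"
      using assms unfolding strict_total_def by auto
  qed
  then show "card (rank n lt ` {..<n}) = card {1..int n}"
    by (simp add: card_image)
  show "rank n lt ` {..<n} \<subseteq> {1..int n}"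
  proof (rule image_subsetI)
    fix i assume i: "i \<in> {..<n}"
    then have "i \<in> {j. j < n \<and> (j = i \<or> lt j i)}"
      by simp
    then have "0 < card {j. j < n \<and> (j = i \<or> lt j i)}"
      by (subst card_gt_0_iff) auto
    moreover have "card {j. j < n \<and> (j = i \<or> lt j i)} \<le> card {..<n}"
      by (intro card_mono) auto
    ultimately show "rank n lt i \<in> {1..int n}"
      by (simp add: rank_def)
  qed
qed simp

text \<open>Such an \<open>f\<close> is injective by cardinality and maps the indices counted by
  \<open>rank n lt i\<close> onto {1..f i}.\<close>

lemma rank_unique:
  assumes "f ` {..<n} = {1..int n}" "\<And>i j. i < n \<Longrightarrow> j < n \<Longrightarrow> f i < f j \<longleftrightarrow> lt i j" "i < n"
  shows "rank n lt i = f i"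
proof -
  have inj: "inj_on f {..<n}"
    using assms(1) by (intro eq_card_imp_inj_on) simp_all
  have "{j. j < n \<and> (j = i \<or> lt j i)} = {j. j < n \<and> f j \<le> f i}"
    using assms(2,3) inj by (auto simp: le_less dest: inj_onD)
  moreover have "f ` {j. j < n \<and> f j \<le> f i} = {1..f i}"
  proof (intro equalityI subsetI)
    fix x assume x: "x \<in> {1..f i}"
    moreover have "f i \<in> {1..int n}"
      using assms(1,3) by auto
    ultimately have "x \<in> f ` {..<n}"
      by (simp add: assms(1))
    with x show "x \<in> f ` {j. j < n \<and> f j \<le> f i}"
      by auto
  qed (use assms(1) in auto)
  moreover have "card (f ` {j. j < n \<and> f j \<le> f i}) = card {j. j < n \<and> f j \<le> f i}"
    by (intro card_image inj_on_subset[OF inj]) auto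
  moreover have "0 < f i"
    using assms(1,3) by force
  ultimately show ?thesis
    by (simp add: rank_def)
qed

lemma nth_image_set: "length xs = n \<Longrightarrow> (!) xs ` {..<n} = set xs"
  by (auto simp: set_conv_nth)

section \<open>Order-isomorphic words\<close>

definition same_order :: "int list \<Rightarrow> int list \<Rightarrow> bool" where
  "same_order xs ys \<longleftrightarrow> length xs = length ys \<and>
     (\<forall>i<length xs. \<forall>j<length xs. xs ! i < xs ! j \<longleftrightarrow> ys ! i < ys ! j)"

lemma same_order_sym: "same_order xs ys \<Longrightarrow> same_order ys xs"
  by (simp add: same_order_def)

lemma same_order_trans: "same_order xs ys \<Longrightarrow> same_order ys zs \<Longrightarrow> same_order xs zs"
  by (simp add: same_order_def)

lemma same_order_separable: "same_order xs ys \<Longrightarrow> order_separable xs \<Longrightarrow> order_separable ys"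
  by (rule order_separable_embed[of xs ys id]) (auto simp: same_order_def)

lemma same_order_descents:
  assumes "same_order xs ys"
  shows "word_des xs = word_des ys" "word_dd l xs = word_dd l ys"
proof -
  have "word_des xs = word_des ys \<and> word_dd l xs = word_dd l ys"
    using assms
  proof (induction xs arbitrary: ys l rule: induct_list012)
    case 1
    then show ?case by (simp add: same_order_def)
  next
    case (2 x)
    then show ?case by (auto simp: same_order_def length_Suc_conv eq_commute[of "Suc _"])
  next
    case (3 x y zs)
    then obtain x' y' zs' where ys: "ys = x' # y' # zs'"
      by (cases ys; cases "tl ys") (auto simp: same_order_def)
    have less: "(x # y # zs) ! i < (x # y # zs) ! j \<longleftrightarrow> ys ! i < ys ! j"
      if "i < Suc (Suc (length zs))" "j < Suc (Suc (length zs))" for i j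
      using 3(3) that by (auto simp: same_order_def)
    have "y < x \<longleftrightarrow> y' < x'"
      using less[of 1 0] by (simp add: ys)
    moreover have "same_order (y # zs) (y' # zs')"
      using 3(3) less[of "Suc _" "Suc _"] by (auto simp: same_order_def ys)
    ultimately show ?case
      using 3(2) by (simp add: ys)
  qed
  then show "word_des xs = word_des ys" "word_dd l xs = word_dd l ys"
    by simp_all
qed

text \<open>The letters of a permutation word are their own ranks, and ranks depend only on the
  order.\<close>

lemma same_order_sep_eq:
  assumes "same_order xs ys" "xs \<in> separable_words n" "ys \<in> separable_words n"
  shows "xs = ys"
proof (rule nth_equalityI)
  fix i assume "i < length xs"
  then have i: "i < n" and n: "length xs = n" "length ys = n" "set xs = {1..int n}" "set ys = {1..int n}"
    using assms by (auto simp: separable_words_def)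
  have "xs ! i = rank n (\<lambda>i j. xs ! i < xs ! j) i"
    by (rule rank_unique[symmetric]) (simp_all add: nth_image_set n i)
  also have "\<dots> = ys ! i"
    by (rule rank_unique) (use assms(1) in \<open>simp_all add: nth_image_set n i same_order_def\<close>)
  finally show "xs ! i = ys ! i" .
qed (use assms in \<open>simp add: separable_words_def\<close>)

definition standardize :: "int list \<Rightarrow> int list" where
  "standardize xs = map (rank (length xs) (\<lambda>i j. xs ! i < xs ! j)) [0..<length xs]"

lemma standardize:
  assumes "distinct xs"
  shows "same_order (standardize xs) xs" "set (standardize xs) = {1..int (length xs)}"
proof -
  let ?lt = "\<lambda>i j. xs ! i < xs ! j"
  have total: "strict_total (length xs) ?lt"
    unfolding strict_total_def
  proof (intro allI impI conjI)
    fix i j assume "i < length xs" "j < length xs" "i \<noteq> j"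
    then have "xs ! i \<noteq> xs ! j"
      using assms by (simp add: nth_eq_iff_index_eq)
    then show "xs ! i < xs ! j \<or> xs ! j < xs ! i"
      by linarith
  qed auto
  show "same_order (standardize xs) xs"
    unfolding same_order_def
  proof (intro conjI allI impI)
    fix i j assume "i < length (standardize xs)" "j < length (standardize xs)"
    then show "standardize xs ! i < standardize xs ! j \<longleftrightarrow> xs ! i < xs ! j"
      using rank_less_iff[OF total, of i j] by (simp add: standardize_def)
  qed (simp add: standardize_def)
  have "rank (length xs) ?lt ` {..<length xs} = {1..int (length xs)}"
    by (rule rank_image[OF total])
  then show "set (standardize xs) = {1..int (length xs)}"
    by (simp add: standardize_def lessThan_atLeast0)
qed

text \<open>The condition on letters of opposite sign expresses avoidance of the two patterns of
  length 2. Given it, separability with a leading 0 replaces the four patterns of length 4, by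
  \<open>avoids_word_iff_sepB\<close>.\<close>

definition separable_signed_words :: "nat \<Rightarrow> int list set" where
  "separable_signed_words n = {xs. length xs = n \<and> abs ` set xs = {1..int n} \<and>
     (\<forall>i j. i < j \<longrightarrow> j < n \<longrightarrow> xs ! i * xs ! j < 0 \<longrightarrow> \<bar>xs ! i\<bar> < \<bar>xs ! j\<bar>) \<and> order_separable (0 # xs)}"

lemma sepB_distinct:
  assumes "xs \<in> separable_signed_words n"
  shows "distinct (map abs xs)" "distinct (0 # xs)"
proof -
  have "card (set (map abs xs)) = length (map abs xs)"
    using assms by (simp add: separable_signed_words_def)
  then show "distinct (map abs xs)"
    by (rule card_distinct)
  moreover have "0 \<notin> abs ` set xs"
    using assms by (simp add: separable_signed_words_def)
  ultimately show "distinct (0 # xs)"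
    by (auto simp: distinct_map)
qed

lemma sepB_nth_nonzero:
  assumes "xs \<in> separable_signed_words n" "i < n"
  shows "xs ! i \<noteq> 0"
proof -
  have "xs ! i \<in> set xs" "0 \<notin> set xs"
    using sepB_distinct(2)[OF assms(1)] assms by (auto simp: separable_signed_words_def)
  then show ?thesis
    by metis
qed

(* order of absolute values of a signed word xs, read off from z = 0 xs up to order isomorphism:
   letters of opposite signs are in increasing order of position. *)
definition abs_less :: "int list \<Rightarrow> nat \<Rightarrow> nat \<Rightarrow> bool" where
  "abs_less z i j =
     (if z ! 0 < z ! Suc i then if z ! 0 < z ! Suc j then z ! Suc i < z ! Suc j else i < j
      else if z ! 0 < z ! Suc j then i < j else z ! Suc j < z ! Suc i)"

text \<open>Absolute values follow the order of the letters among positive letters, the reverse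
  order among negative ones, and the position across signs.\<close>

lemma abs_less_sepB:
  assumes "xs \<in> separable_signed_words n" "i < n" "j < n"
  shows "\<bar>xs ! i\<bar> < \<bar>xs ! j\<bar> \<longleftrightarrow> abs_less (0 # xs) i j"
proof -
  have opp: "\<bar>xs ! p\<bar> < \<bar>xs ! q\<bar>" if "p < q" "q < n" "xs ! p * xs ! q < 0" for p q
    using assms(1) that by (auto simp: separable_signed_words_def)
  have nz: "xs ! i \<noteq> 0" "xs ! j \<noteq> 0"
    using sepB_nth_nonzero assms by blast+
  consider "xs ! i > 0" "xs ! j > 0" | "xs ! i < 0" "xs ! j < 0" | "xs ! i * xs ! j < 0"
    using nz by (auto simp: mult_less_0_iff neq_iff)
  then show ?thesis
  proof cases
    case 3
    then have "i \<noteq> j"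
      by (metis mult_less_0_iff less_asym)
    then have "\<bar>xs ! i\<bar> < \<bar>xs ! j\<bar> \<longleftrightarrow> i < j"
      using opp[of i j] opp[of j i] assms 3 by (metis less_asym linorder_neqE_nat mult.commute)
    then show ?thesis
      using 3 by (auto simp: abs_less_def mult_less_0_iff)
  qed (auto simp: abs_less_def)
qed

lemma abs_less_same_order:
  assumes "same_order z z'" "Suc i < length z" "Suc j < length z"
  shows "abs_less z i j \<longleftrightarrow> abs_less z' i j"
proof -
  have less: "z ! p < z ! q \<longleftrightarrow> z' ! p < z' ! q" if "p < length z" "q < length z" for p q
    using assms(1) that by (simp add: same_order_def)
  have "0 < length z"
    using assms(2) by linarith
  then show ?thesis
    using assms(2,3) by (simp add: abs_less_def less)
qed

lemma abs_less_irrefl: "\<not> abs_less z i i"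
  by (simp add: abs_less_def)

lemma abs_less_total:
  assumes "distinct z" "Suc i < length z" "Suc j < length z" "i \<noteq> j"
  shows "abs_less z i j \<or> abs_less z j i"
proof -
  have "z ! Suc i \<noteq> z ! Suc j"
    using assms by (simp add: nth_eq_iff_index_eq)
  then show ?thesis
    using assms(4) unfolding abs_less_def by auto
qed

(* a failure of transitivity is a 2413 or 3142 whose first letter is that of z. *)
lemma abs_less_trans:
  assumes "order_separable z" "distinct z" "Suc i < length z" "Suc j < length z" "Suc k < length z"
    "abs_less z i j" "abs_less z j k"
  shows "abs_less z i k"
proof -
  have K: "\<not> (z ! Suc q < z ! 0 \<and> z ! 0 < z ! Suc r \<and> z ! Suc r < z ! Suc p)"
    "\<not> (z ! Suc p < z ! Suc r \<and> z ! Suc r < z ! 0 \<and> z ! 0 < z ! Suc q)"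
    if "p < q" "q < r" "Suc r < length z" for p q r
    using order_separableD[OF assms(1), of 0 "Suc p" "Suc q" "Suc r"] that by auto
  note K1 = K[of i j k, OF _ _ assms(5)] and K2 = K[of j k i, OF _ _ assms(3)]
    and K3 = K[of k i j, OF _ _ assms(4)]
  have "0 < length z"
    using assms(3) by linarith
  then have ne: "z ! Suc i \<noteq> z ! 0" "z ! Suc j \<noteq> z ! 0" "z ! Suc k \<noteq> z ! 0"
    using assms(2-5) by (simp_all add: nth_eq_iff_index_eq)
  have eq: "z ! Suc i = z ! Suc k \<longleftrightarrow> i = k"
    using assms(2-5) by (simp add: nth_eq_iff_index_eq)
  let ?p = "\<lambda>m. z ! 0 < z ! Suc m"
  \<comment> \<open>At least two of the three letters lie on the same side of \<open>z ! 0\<close>: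
    all three agree, or the odd one out is \<open>k\<close>, \<open>i\<close> or \<open>j\<close>,
    in this order.\<close>
  consider "?p i \<longleftrightarrow> ?p j" "?p j \<longleftrightarrow> ?p k" | "?p i \<longleftrightarrow> ?p j" "?p k \<longleftrightarrow> \<not> ?p i"
    | "?p j \<longleftrightarrow> ?p k" "?p i \<longleftrightarrow> \<not> ?p k" | "?p i \<longleftrightarrow> ?p k" "?p j \<longleftrightarrow> \<not> ?p i"
    by blast
  then show ?thesis
  proof cases
    case 1
    then show ?thesis
      using assms(6,7) by (auto simp: abs_less_def split: if_splits)
  next
    case 2
    then have "j < k" "?p i \<Longrightarrow> z ! Suc i < z ! Suc j" "\<not> ?p i \<Longrightarrow> z ! Suc j < z ! Suc i"
      using assms(6,7) by (auto simp: abs_less_def split: if_splits)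
    then have "\<not> k < i"
      using 2 ne K2 by linarith
    then have "i < k"
      using 2 by (metis linorder_neqE_nat)
    then show ?thesis
      using 2 by (auto simp: abs_less_def)
  next
    case 3
    then have "i < j" "?p j \<Longrightarrow> z ! Suc j < z ! Suc k" "\<not> ?p j \<Longrightarrow> z ! Suc k < z ! Suc j"
      using assms(6,7) by (auto simp: abs_less_def split: if_splits)
    then have "\<not> k < i"
      using 3 ne K3 by linarith
    then have "i < k"
      using 3 by (metis linorder_neqE_nat)
    then show ?thesis
      using 3 by (auto simp: abs_less_def)
  next
    case 4
    then have "i < j" "j < k"
      using assms(6,7) by (auto simp: abs_less_def split: if_splits)
    then have "?p i \<Longrightarrow> z ! Suc i < z ! Suc k" "\<not> ?p i \<Longrightarrow> z ! Suc k < z ! Suc i"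
      using 4 ne eq K1 by linarith+
    then show ?thesis
      using 4 by (auto simp: abs_less_def)
  qed
qed

text \<open>The first letter of \<open>z\<close> plays the part of 0: comparison with it gives the
  sign.\<close>

definition unstandardize :: "int list \<Rightarrow> int list" where
  "unstandardize z = map (\<lambda>i. (if z ! 0 < z ! Suc i then 1 else -1) * rank (length z - 1) (abs_less z) i)
     [0..<length z - 1]"

lemma unstandardize_same_order:
  assumes "xs \<in> separable_signed_words n" "same_order (0 # xs) z"
  shows "unstandardize z = xs"
proof (rule nth_equalityI)
  have n: "length xs = n" "length z = Suc n" "abs ` set xs = {1..int n}"
    using assms by (auto simp: separable_signed_words_def same_order_def)
  then show "length (unstandardize z) = length xs"
    by (simp add: unstandardize_def)
  fix i assume "i < length (unstandardize z)"
  then have i: "i < n"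
    using n by (simp add: unstandardize_def)
  have "(\<lambda>i. \<bar>xs ! i\<bar>) ` {..<n} = abs ` (!) xs ` {..<n}"
    by (simp add: image_image)
  then have "rank n (abs_less z) i = \<bar>xs ! i\<bar>"
    using n i assms abs_less_same_order[OF assms(2)]
    by (intro rank_unique) (simp_all add: nth_image_set abs_less_sepB)
  moreover have "0 < xs ! i \<longleftrightarrow> z ! 0 < z ! Suc i"
    using assms(2) i n unfolding same_order_def
    by (metis Suc_less_eq length_Cons nth_Cons_0 nth_Cons_Suc zero_less_Suc)
  ultimately show "unstandardize z ! i = xs ! i"
    using i n sepB_nth_nonzero[OF assms(1) i] by (auto simp: unstandardize_def)
qed

text \<open>Separability of \<open>z\<close> enters through transitivity of \<open>abs_less\<close>;
  once this relation is a strict total order, its ranks are absolute values that realize it.\<close>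

lemma unstandardize:
  assumes "z \<in> separable_words (Suc n)"
  shows "unstandardize z \<in> separable_signed_words n" "same_order (0 # unstandardize z) z"
proof -
  let ?xs = "unstandardize z" and ?r = "rank n (abs_less z)"
  have len: "length z = Suc n" and sep: "order_separable z" and dist: "distinct z"
    using assms sep_distinct by (auto simp: separable_words_def)
  have "strict_total n (abs_less z)"
    unfolding strict_total_def
  proof (intro allI impI conjI)
    show "abs_less z i j \<or> abs_less z j i" if "i < n" "j < n" "i \<noteq> j" for i j
      using abs_less_total[OF dist _ _ that(3)] that len by simp
    show "abs_less z i k" if "i < n" "j < n" "k < n" "abs_less z i j" "abs_less z j k" for i j k
      using abs_less_trans[OF sep dist _ _ _ that(4,5)] that len by simp
  qed (rule abs_less_irrefl)
  note less = rank_less_iff[OF this] and img = rank_image[OF this]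
  from img have pos: "0 < ?r i" if "i < n" for i
    using that by force
  have xs: "?xs ! i = (if z ! 0 < z ! Suc i then 1 else -1) * ?r i" if "i < n" for i
    using that len by (simp add: unstandardize_def)
  have len': "length ?xs = n"
    using len by (simp add: unstandardize_def)
  have abs: "\<bar>?xs ! i\<bar> = ?r i" and sgn: "?xs ! i > 0 \<longleftrightarrow> z ! 0 < z ! Suc i"
    "?xs ! i < 0 \<longleftrightarrow> \<not> z ! 0 < z ! Suc i" if "i < n" for i
    using pos[OF that] that by (auto simp: xs)
  have ne: "z ! Suc i \<noteq> z ! 0" if "i < n" for i
    using dist len that by (simp add: nth_eq_iff_index_eq)
  have "(0 # ?xs) ! i < (0 # ?xs) ! j \<longleftrightarrow> z ! i < z ! j" if "i < Suc n" "j < Suc n" for i j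
  proof (cases i; cases j)
    fix i' j' assume [simp]: "i = Suc i'" "j = Suc j'"
    then have ij: "i' < n" "j' < n"
      using that by auto
    \<comment> \<open>Across signs the sign alone decides; within one sign \<open>abs_less\<close>
      is the order of the letters of \<open>z\<close> or its reverse.\<close>
    show ?thesis
      using less[OF ij] less[OF ij(2,1)] pos[OF ij(1)] pos[OF ij(2)] ne[OF ij(1)] ne[OF ij(2)]
      by (auto simp: xs ij abs_less_def)
  qed (use that sgn ne in \<open>auto simp: not_less le_less\<close>)
  then show so: "same_order (0 # ?xs) z"
    using len len' by (simp add: same_order_def)
  have "abs ` set ?xs = (\<lambda>i. \<bar>?xs ! i\<bar>) ` {..<n}"
    using nth_image_set[OF len'] by (metis image_image)
  also have "\<dots> = {1..int n}"
    using abs img by simp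
  finally have "abs ` set ?xs = {1..int n}" .
  moreover have "\<bar>?xs ! i\<bar> < \<bar>?xs ! j\<bar>" if "i < j" "j < n" "?xs ! i * ?xs ! j < 0" for i j
    using that less[of i j] sgn[of i] sgn[of j] abs[of i] abs[of j]
    by (auto simp: mult_less_0_iff abs_less_def)
  moreover have "order_separable (0 # ?xs)"
    using same_order_separable[OF same_order_sym[OF so] sep] .
  ultimately show "?xs \<in> separable_signed_words n"
    using len' by (simp add: separable_signed_words_def)
qed

lemma bij_betw_standardize: "bij_betw (\<lambda>xs. standardize (0 # xs)) (separable_signed_words n) (separable_words (Suc n))"
proof (rule bij_betw_byWitness[where f' = unstandardize])
  have so: "same_order (0 # xs) (standardize (0 # xs))" if "xs \<in> separable_signed_words n" for xs
    using standardize(1)[OF sepB_distinct(2)[OF that]] by (rule same_order_sym)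
  then show "\<forall>xs\<in>separable_signed_words n. unstandardize (standardize (0 # xs)) = xs"
    using unstandardize_same_order by blast
  show sub: "(\<lambda>xs. standardize (0 # xs)) ` separable_signed_words n \<subseteq> separable_words (Suc n)"
  proof (rule image_subsetI)
    fix xs assume xs: "xs \<in> separable_signed_words n"
    have "order_separable (standardize (0 # xs))"
      by (rule same_order_separable[OF so[OF xs]]) (use xs in \<open>simp add: separable_signed_words_def\<close>)
    then show "standardize (0 # xs) \<in> separable_words (Suc n)"
      using standardize(2)[OF sepB_distinct(2)[OF xs]] xs
      by (simp add: separable_words_def separable_signed_words_def standardize_def)
  qed
  show sub': "unstandardize ` separable_words (Suc n) \<subseteq> separable_signed_words n"
    using unstandardize(1) by blast
  show "\<forall>z\<in>separable_words (Suc n). standardize (0 # unstandardize z) = z"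
  proof
    fix z assume z: "z \<in> separable_words (Suc n)"
    then have "unstandardize z \<in> separable_signed_words n"
      by (rule unstandardize)
    then have "same_order (standardize (0 # unstandardize z)) z"
      "standardize (0 # unstandardize z) \<in> separable_words (Suc n)"
      using same_order_trans[OF same_order_sym[OF so] unstandardize(2)[OF z]] sub by auto
    then show "standardize (0 # unstandardize z) = z"
      using z by (rule same_order_sep_eq)
  qed
qed

lemma standardize_descents:
  assumes "xs \<in> separable_signed_words n"
  shows "word_des (standardize (0 # xs)) = word_des (0 # xs)" "word_dd l (standardize (0 # xs)) = word_dd l (0 # xs)"
  using same_order_descents[OF standardize(1)[OF sepB_distinct(2)[OF assms]]] by auto

section \<open>Pattern avoidance in one-line notation\<close>

text \<open>The offset \<open>m\<close> lets the equivalence be applied to its own right-hand side,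
  which turns a subsequence of fixed length into a chain of increasing positions.\<close>

lemma subseq_Cons_drop:
  "subseq (x # v) (drop m xs) \<longleftrightarrow>
     (\<exists>i\<ge>m. i < length xs \<and> xs ! i = x \<and> subseq v (drop (Suc i) xs))"
proof
  assume "subseq (x # v) (drop m xs)"
  then obtain us y vs where *: "drop m xs = us @ y # vs" "x = y" "subseq v vs"
    by (auto dest!: list_emb_ConsD)
  have "m < length xs"
    using arg_cong[OF *(1), of length] by simp
  then have "xs = (take m xs @ us) @ y # vs" "length (take m xs @ us) = m + length us"
    using append_take_drop_id[of m xs] *(1) by simp_all
  then have "m + length us < length xs" "xs ! (m + length us) = x" "drop (Suc (m + length us)) xs = vs"
    using \<open>x = y\<close> by (metis add_less_cancel_left length_append length_Cons less_add_Suc1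
        add_Suc_right, metis nth_append_length, metis append_eq_conv_conj drop_Suc_Cons drop_drop plus_1_eq_Suc drop0 drop_Suc tl_drop list.sel(3))
  then show "\<exists>i\<ge>m. i < length xs \<and> xs ! i = x \<and> subseq v (drop (Suc i) xs)"
    using *(3) by (intro exI[of _ "m + length us"]) auto
next
  assume "\<exists>i\<ge>m. i < length xs \<and> xs ! i = x \<and> subseq v (drop (Suc i) xs)"
  then obtain i where i: "m \<le> i" "i < length xs" "xs ! i = x" "subseq v (drop (Suc i) xs)"
    by blast
  then have "subseq (x # v) (drop i xs)"
    using Cons_nth_drop_Suc[OF i(2)] by (metis subseq_Cons2)
  moreover have "drop i xs = drop (i - m) (drop m xs)"
    using i(1) by simp
  ultimately show "subseq (x # v) (drop m xs)"
    by (metis append_take_drop_id subseq_drop_many)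
qed

lemma subseq_Cons_iff:
  "subseq (x # v) xs \<longleftrightarrow> (\<exists>i<length xs. xs ! i = x \<and> subseq v (drop (Suc i) xs))"
  using subseq_Cons_drop[of x v 0 xs] by simp

text \<open>The absolute values of \<open>sts v\<close> are the ranks of those of \<open>v\<close>.
  By \<open>rank_unique\<close>, \<open>u\<close> has the same ones as soon as its absolute values
  compare in the same way.\<close>

lemma sts_eq_iff:
  assumes "distinct (map abs v)" "0 \<notin> set v" "abs ` set u = {1..int (length u)}"
  shows "sts v = u \<longleftrightarrow> length v = length u \<and> (\<forall>i<length u. sgn (v ! i) = sgn (u ! i)) \<and>
     (\<forall>i<length u. \<forall>j<length u. \<bar>v ! i\<bar> < \<bar>v ! j\<bar> \<longleftrightarrow> \<bar>u ! i\<bar> < \<bar>u ! j\<bar>)"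
proof
  assume "sts v = u"
  then show "length v = length u \<and> (\<forall>i<length u. sgn (v ! i) = sgn (u ! i)) \<and>
     (\<forall>i<length u. \<forall>j<length u. \<bar>v ! i\<bar> < \<bar>v ! j\<bar> \<longleftrightarrow> \<bar>u ! i\<bar> < \<bar>u ! j\<bar>)"
    using length_sts sgn_sts abs_sts_less_iff[OF assms(2)] by fastforce
next
  assume *: "length v = length u \<and> (\<forall>i<length u. sgn (v ! i) = sgn (u ! i)) \<and>
     (\<forall>i<length u. \<forall>j<length u. \<bar>v ! i\<bar> < \<bar>v ! j\<bar> \<longleftrightarrow> \<bar>u ! i\<bar> < \<bar>u ! j\<bar>)"
  have inj: "\<bar>v ! i\<bar> = \<bar>v ! j\<bar> \<longleftrightarrow> i = j" if "i < length v" "j < length v" for i j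
    using nth_eq_iff_index_eq[OF assms(1), of i j] that by simp
  show "sts v = u"
  proof (rule nth_equalityI)
    fix i assume "i < length (sts v)"
    then have i: "i < length v"
      by (simp add: length_sts)
    let ?J = "{j. j < length v \<and> (j = i \<or> \<bar>v ! j\<bar> < \<bar>v ! i\<bar>)}"
    have "{y \<in> set v. \<bar>y\<bar> \<le> \<bar>v ! i\<bar>} = (!) v ` ?J"
      using i inj by (auto simp: in_set_conv_nth le_less)
    moreover have "inj_on ((!) v) ?J"
      using inj by (intro inj_onI) (metis (mono_tags, lifting) mem_Collect_eq)
    ultimately have "int (card {y \<in> set v. \<bar>y\<bar> \<le> \<bar>v ! i\<bar>}) = rank (length v) (\<lambda>i j. \<bar>v ! i\<bar> < \<bar>v ! j\<bar>) i"
      by (simp add: card_image rank_def)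
    also have "\<dots> = \<bar>u ! i\<bar>"
    proof (rule rank_unique)
      have "(\<lambda>i. \<bar>u ! i\<bar>) ` {..<length v} = abs ` (!) u ` {..<length v}"
        by (simp add: image_image)
      then show "(\<lambda>i. \<bar>u ! i\<bar>) ` {..<length v} = {1..int (length v)}"
        using * assms(3) by (simp add: nth_image_set)
    qed (use * i in auto)
    finally show "sts v ! i = u ! i"
      using * i by (simp add: sts_def sgn_mult_abs)
  qed (use * in \<open>simp add: length_sts\<close>)
qed

lemma sts_patterns_2:
  fixes a b :: int
  assumes "distinct (map abs [a, b])" "0 \<notin> set [a, b]"
  shows "sts [a, b] = [-2, 1] \<longleftrightarrow> a < 0 \<and> 0 < b \<and> b < - a"
    and "sts [a, b] = [2, -1] \<longleftrightarrow> 0 < a \<and> b < 0 \<and> - b < a"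
proof -
  have len: "length [x, y] = Suc (Suc 0)" for x y :: int
    by simp
  have set: "abs ` set [-2, 1 :: int] = {1..int (length [-2, 1 :: int])}"
    "abs ` set [2, -1 :: int] = {1..int (length [2, -1 :: int])}"
    by auto
  show "sts [a, b] = [-2, 1] \<longleftrightarrow> a < 0 \<and> 0 < b \<and> b < - a"
    unfolding sts_eq_iff[OF assms set(1)] len All_less_Suc
    by (simp add: sgn_1_pos sgn_1_neg) linarith
  show "sts [a, b] = [2, -1] \<longleftrightarrow> 0 < a \<and> b < 0 \<and> - b < a"
    unfolding sts_eq_iff[OF assms set(2)] len All_less_Suc
    by (simp add: sgn_1_pos sgn_1_neg) linarith
qed

text \<open>Negative letters compare in the opposite way to their absolute values, so barred 3142
  has the letter order of 2413 and vice versa. One sign condition, on the letter nearest to 0,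
  settles all four signs.\<close>

lemma sts_patterns_4:
  fixes a b c d :: int
  assumes "distinct (map abs [a, b, c, d])" "0 \<notin> set [a, b, c, d]"
  shows "sts [a, b, c, d] = [3, 1, 4, 2] \<longleftrightarrow> 0 < b \<and> b < d \<and> d < a \<and> a < c"
    and "sts [a, b, c, d] = [2, 4, 1, 3] \<longleftrightarrow> 0 < c \<and> c < a \<and> a < d \<and> d < b"
    and "sts [a, b, c, d] = [-3, -1, -4, -2] \<longleftrightarrow> b < 0 \<and> d < b \<and> a < d \<and> c < a"
    and "sts [a, b, c, d] = [-2, -4, -1, -3] \<longleftrightarrow> c < 0 \<and> a < c \<and> d < a \<and> b < d"
proof -
  have len: "length [w, x, y, z] = Suc (Suc (Suc (Suc 0)))" for w x y z :: int
    by simp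
  have set: "abs ` set [3, 1, 4, 2 :: int] = {1..int (length [3, 1, 4, 2 :: int])}"
    "abs ` set [2, 4, 1, 3 :: int] = {1..int (length [2, 4, 1, 3 :: int])}"
    "abs ` set [-3, -1, -4, -2 :: int] = {1..int (length [-3, -1, -4, -2 :: int])}"
    "abs ` set [-2, -4, -1, -3 :: int] = {1..int (length [-2, -4, -1, -3 :: int])}"
    by auto
  show "sts [a, b, c, d] = [3, 1, 4, 2] \<longleftrightarrow> 0 < b \<and> b < d \<and> d < a \<and> a < c"
    unfolding sts_eq_iff[OF assms set(1)] len All_less_Suc
    by (simp add: sgn_1_pos) linarith
  show "sts [a, b, c, d] = [2, 4, 1, 3] \<longleftrightarrow> 0 < c \<and> c < a \<and> a < d \<and> d < b"
    unfolding sts_eq_iff[OF assms set(2)] len All_less_Suc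
    by (simp add: sgn_1_pos) linarith
  show "sts [a, b, c, d] = [-3, -1, -4, -2] \<longleftrightarrow> b < 0 \<and> d < b \<and> a < d \<and> c < a"
    unfolding sts_eq_iff[OF assms set(3)] len All_less_Suc
    by (simp add: sgn_1_neg) linarith
  show "sts [a, b, c, d] = [-2, -4, -1, -3] \<longleftrightarrow> c < 0 \<and> a < c \<and> d < a \<and> b < d"
    unfolding sts_eq_iff[OF assms set(4)] len All_less_Suc
    by (simp add: sgn_1_neg) linarith
qed

definition signed_words :: "nat \<Rightarrow> int list set" where
  "signed_words n = {xs. length xs = n \<and> abs ` set xs = {1..int n}}"

lemma signed_words_nth:
  assumes "xs \<in> signed_words n"
  shows "i < n \<Longrightarrow> xs ! i \<noteq> 0" "i < n \<Longrightarrow> j < n \<Longrightarrow> \<bar>xs ! i\<bar> = \<bar>xs ! j\<bar> \<longleftrightarrow> i = j"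
proof -
  have n: "length xs = n" "abs ` set xs = {1..int n}"
    using assms by (auto simp: signed_words_def)
  have "0 \<notin> abs ` set xs"
    by (simp add: n)
  then show "xs ! i \<noteq> 0" if "i < n"
    using that n(1) nth_mem[of i xs] by force
  have "distinct (map abs xs)"
    by (rule card_distinct) (simp add: n)
  then show "\<bar>xs ! i\<bar> = \<bar>xs ! j\<bar> \<longleftrightarrow> i = j" if "i < n" "j < n"
    using nth_eq_iff_index_eq[of "map abs xs" i j] that n(1) by simp
qed

definition avoids_word :: "int list \<Rightarrow> int list \<Rightarrow> bool" where
  "avoids_word xs u \<longleftrightarrow> \<not> (\<exists>v. subseq v xs \<and> sts v = u)"

lemma subseq_2_iff:
  "subseq [a, b] xs \<longleftrightarrow> (\<exists>i j. i < j \<and> j < length xs \<and> xs ! i = a \<and> xs ! j = b)"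
  (is "?L \<longleftrightarrow> ?R")
proof
  assume ?L
  then show ?R
    unfolding subseq_Cons_iff[of _ _ xs] subseq_Cons_drop Suc_le_eq by blast
next
  assume ?R
  then obtain i j where "i < j" "j < length xs" "xs ! i = a" "xs ! j = b"
    by blast
  moreover from this have "i < length xs"
    by linarith
  ultimately show ?L
    unfolding subseq_Cons_iff[of _ _ xs] subseq_Cons_drop Suc_le_eq by blast
qed

lemma subseq_4_iff:
  "subseq [a, b, c, d] xs \<longleftrightarrow> (\<exists>i j k l. i < j \<and> j < k \<and> k < l \<and> l < length xs \<and>
     xs ! i = a \<and> xs ! j = b \<and> xs ! k = c \<and> xs ! l = d)"
  (is "?L \<longleftrightarrow> ?R")
proof
  assume ?L
  then show ?R
    unfolding subseq_Cons_iff[of _ _ xs] subseq_Cons_drop Suc_le_eq by blast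
next
  assume ?R
  then obtain i j k l where "i < j" "j < k" "k < l" "l < length xs"
    "xs ! i = a" "xs ! j = b" "xs ! k = c" "xs ! l = d"
    by blast
  moreover from this have "i < length xs" "j < length xs" "k < length xs"
    by linarith+
  ultimately show ?L
    unfolding subseq_Cons_iff[of _ _ xs] subseq_Cons_drop Suc_le_eq by blast
qed

lemma avoids_word_2:
  "avoids_word xs [s, t] \<longleftrightarrow> (\<forall>i j. i < j \<longrightarrow> j < length xs \<longrightarrow> sts [xs ! i, xs ! j] \<noteq> [s, t])"
proof -
  have "\<exists>a b. v = [a, b]" if "sts v = [s, t]" for v
    using that length_sts[of v] by (auto simp: length_Suc_conv eq_commute[of "Suc _"])
  then have "(\<exists>v. subseq v xs \<and> sts v = [s, t]) \<longleftrightarrow> (\<exists>a b. subseq [a, b] xs \<and> sts [a, b] = [s, t])"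
    by metis
  also have "\<dots> \<longleftrightarrow> (\<exists>i j. i < j \<and> j < length xs \<and> sts [xs ! i, xs ! j] = [s, t])"
    unfolding subseq_2_iff by blast
  finally show ?thesis
    unfolding avoids_word_def by blast
qed

lemma avoids_word_4:
  "avoids_word xs [s, t, p, q] \<longleftrightarrow> (\<forall>i j k l. i < j \<longrightarrow> j < k \<longrightarrow> k < l \<longrightarrow> l < length xs \<longrightarrow>
     sts [xs ! i, xs ! j, xs ! k, xs ! l] \<noteq> [s, t, p, q])"
proof -
  have "\<exists>a b c d. v = [a, b, c, d]" if "sts v = [s, t, p, q]" for v
    using that length_sts[of v] by (auto simp: length_Suc_conv eq_commute[of "Suc _"])
  then have "(\<exists>v. subseq v xs \<and> sts v = [s, t, p, q]) \<longleftrightarrow>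
      (\<exists>a b c d. subseq [a, b, c, d] xs \<and> sts [a, b, c, d] = [s, t, p, q])"
    by metis
  also have "\<dots> \<longleftrightarrow> (\<exists>i j k l. i < j \<and> j < k \<and> k < l \<and> l < length xs \<and>
      sts [xs ! i, xs ! j, xs ! k, xs ! l] = [s, t, p, q])"
    unfolding subseq_4_iff by blast
  finally show ?thesis
    unfolding avoids_word_def by blast
qed

text \<open>Here \<open>b\<close> is the least and \<open>c\<close> the greatest letter, so the
  conclusion says that the signs are not mixed. If b < 0 < c, then d < 0 would give |b| < |c| < |d|,
  contrary to b < d < 0; and d > 0 makes a > 0, so that |a| < |b| < |d|, contrary to d < a.\<close>

lemma constant_sign_3142:
  fixes a b c d :: int
  assumes nz: "a \<noteq> 0" "d \<noteq> 0" and pat: "b < d" "d < a" "a < c"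
    and opp: "a * b < 0 \<Longrightarrow> \<bar>a\<bar> < \<bar>b\<bar>" "b * c < 0 \<Longrightarrow> \<bar>b\<bar> < \<bar>c\<bar>" "c * d < 0 \<Longrightarrow> \<bar>c\<bar> < \<bar>d\<bar>"
      "b * d < 0 \<Longrightarrow> \<bar>b\<bar> < \<bar>d\<bar>"
  shows "0 \<le> b \<or> c \<le> 0"
proof (rule ccontr)
  assume "\<not> ?thesis"
  then have bc: "b < 0" "0 < c"
    by auto
  have "\<bar>b\<bar> < \<bar>c\<bar>"
    using opp(2) bc by (simp add: mult_less_0_iff)
  have "\<not> d < 0"
  proof
    assume "d < 0"
    then have "\<bar>c\<bar> < \<bar>d\<bar>"
      using opp(3) bc by (simp add: mult_less_0_iff)
    then show False
      using \<open>\<bar>b\<bar> < \<bar>c\<bar>\<close> \<open>d < 0\<close> bc pat by linarith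
  qed
  then have "0 < d" "0 < a"
    using nz pat by auto
  then have "\<bar>a\<bar> < \<bar>b\<bar>" "\<bar>b\<bar> < \<bar>d\<bar>"
    using opp(1,4) bc by (auto simp: mult_less_0_iff)
  then show False
    using pat \<open>0 < d\<close> by linarith
qed

text \<open>Once the patterns of length 2 are avoided, every occurrence of 3142 or 2413 in the
  letter order has constant sign and hence is one of the four signed patterns, while the leading 0
  takes part in no occurrence.\<close>

lemma avoids_word_iff_sepB:
  assumes xs: "xs \<in> signed_words n"
  shows "(\<forall>u\<in>separable_patterns. avoids_word xs u) \<longleftrightarrow> xs \<in> separable_signed_words n"
proof -
  have n: "length xs = n"
    using xs by (simp add: signed_words_def)
  note nz = signed_words_nth(1)[OF xs] and inj = signed_words_nth(2)[OF xs]
  let ?opp = "\<forall>i j. i < j \<longrightarrow> j < n \<longrightarrow> xs ! i * xs ! j < 0 \<longrightarrow> \<bar>xs ! i\<bar> < \<bar>xs ! j\<bar>"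
  have two: "avoids_word xs [-2, 1] \<and> avoids_word xs [2, -1] \<longleftrightarrow> ?opp"
  proof -
    have "sts [xs ! i, xs ! j] \<noteq> [-2, 1] \<and> sts [xs ! i, xs ! j] \<noteq> [2, -1] \<longleftrightarrow>
        (xs ! i * xs ! j < 0 \<longrightarrow> \<bar>xs ! i\<bar> < \<bar>xs ! j\<bar>)" if "i < j" "j < n" for i j
    proof -
      have ne: "\<bar>xs ! i\<bar> \<noteq> \<bar>xs ! j\<bar>" "xs ! i \<noteq> 0" "xs ! j \<noteq> 0"
        using inj[of i j] nz[of i] nz[of j] that by auto
      then have "distinct (map abs [xs ! i, xs ! j])" "0 \<notin> set [xs ! i, xs ! j]"
        by auto
      note sts_patterns_2[OF this]
      then show ?thesis
        using ne by (auto simp: mult_less_0_iff)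
    qed
    then show ?thesis
      unfolding avoids_word_2 n by blast
  qed
  have four: "avoids_word xs [3, 1, 4, 2] \<and> avoids_word xs [2, 4, 1, 3] \<and>
      avoids_word xs [-3, -1, -4, -2] \<and> avoids_word xs [-2, -4, -1, -3] \<longleftrightarrow> order_separable (0 # xs)"
    if opp: ?opp
  proof -
    let ?av = "\<lambda>i j k l. sts [xs ! i, xs ! j, xs ! k, xs ! l] \<notin>
      {[3, 1, 4, 2], [2, 4, 1, 3], [-3, -1, -4, -2], [-2, -4, -1, -3]}"
    let ?os = "\<lambda>a b c d :: int. \<not> (b < d \<and> d < a \<and> a < c) \<and> \<not> (c < a \<and> a < d \<and> d < b)"
    have main: "?av i j k l \<longleftrightarrow> ?os (xs ! i) (xs ! j) (xs ! k) (xs ! l)"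
      if ij: "i < j" "j < k" "k < l" "l < n" for i j k l
    proof -
      have nz': "xs ! i \<noteq> 0" "xs ! j \<noteq> 0" "xs ! k \<noteq> 0" "xs ! l \<noteq> 0"
        using nz ij by auto
      have "distinct (map abs [xs ! i, xs ! j, xs ! k, xs ! l])"
        using inj ij by auto
      note pats = sts_patterns_4[OF this]
      have o: "xs ! i * xs ! j < 0 \<Longrightarrow> \<bar>xs ! i\<bar> < \<bar>xs ! j\<bar>" "xs ! j * xs ! k < 0 \<Longrightarrow> \<bar>xs ! j\<bar> < \<bar>xs ! k\<bar>"
        "xs ! k * xs ! l < 0 \<Longrightarrow> \<bar>xs ! k\<bar> < \<bar>xs ! l\<bar>" "xs ! j * xs ! l < 0 \<Longrightarrow> \<bar>xs ! j\<bar> < \<bar>xs ! l\<bar>"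
        using opp ij by auto
      have c1: "0 < xs ! j \<or> xs ! k < 0" if "xs ! j < xs ! l" "xs ! l < xs ! i" "xs ! i < xs ! k"
        using constant_sign_3142[OF nz'(1,4) that o] nz' by linarith
      have c2: "xs ! j < 0 \<or> 0 < xs ! k" if "xs ! k < xs ! i" "xs ! i < xs ! l" "xs ! l < xs ! j"
      proof -
        \<comment> \<open>Negating the letters turns 2413 into 3142 and keeps absolute
          values.\<close>
        have "0 \<le> - xs ! j \<or> - xs ! k \<le> 0"
          by (rule constant_sign_3142[of "- xs ! i" "- xs ! l"]) (use nz' that o in auto)
        then show ?thesis
          using nz' by linarith
      qed
      have "?av i j k l \<longleftrightarrow> \<not> (0 < xs ! j \<and> xs ! j < xs ! l \<and> xs ! l < xs ! i \<and> xs ! i < xs ! k)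
          \<and> \<not> (0 < xs ! k \<and> xs ! k < xs ! i \<and> xs ! i < xs ! l \<and> xs ! l < xs ! j)
          \<and> \<not> (xs ! j < 0 \<and> xs ! l < xs ! j \<and> xs ! i < xs ! l \<and> xs ! k < xs ! i)
          \<and> \<not> (xs ! k < 0 \<and> xs ! i < xs ! k \<and> xs ! l < xs ! i \<and> xs ! j < xs ! l)"
        using pats nz' by auto
      then show ?thesis
        using c1 c2 by blast
    qed
    \<comment> \<open>If 0 were the first letter of an occurrence, the second and third letters
      would have opposite signs, and so would the third and fourth; hence the fourth would exceed
      the second in absolute value, but in both patterns it lies strictly between 0 and the
      second.\<close>
    have zero: "?os 0 (xs ! j) (xs ! k) (xs ! l)" if jk: "j < k" "k < l" "l < n" for j k l
    proof -
      have "xs ! j * xs ! k < 0 \<Longrightarrow> \<bar>xs ! j\<bar> < \<bar>xs ! k\<bar>" "xs ! k * xs ! l < 0 \<Longrightarrow> \<bar>xs ! k\<bar> < \<bar>xs ! l\<bar>"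
        using opp jk by auto
      then show ?thesis
        by (auto simp: mult_less_0_iff)
    qed
    have "order_separable (0 # xs) \<longleftrightarrow> (\<forall>i j k l. i < j \<longrightarrow> j < k \<longrightarrow> k < l \<longrightarrow> l < n \<longrightarrow>
        ?os (xs ! i) (xs ! j) (xs ! k) (xs ! l))"
    proof
      assume "order_separable (0 # xs)"
      then show "\<forall>i j k l. i < j \<longrightarrow> j < k \<longrightarrow> k < l \<longrightarrow> l < n \<longrightarrow> ?os (xs ! i) (xs ! j) (xs ! k) (xs ! l)"
        using order_separableD[of "0 # xs" "Suc _" "Suc _" "Suc _" "Suc _"] n by simp
    next
      assume r: "\<forall>i j k l. i < j \<longrightarrow> j < k \<longrightarrow> k < l \<longrightarrow> l < n \<longrightarrow> ?os (xs ! i) (xs ! j) (xs ! k) (xs ! l)"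
      show "order_separable (0 # xs)"
        unfolding order_separable_def
      proof (intro allI impI)
        fix i j k l assume *: "i < j" "j < k" "k < l" "l < length (0 # xs)"
        then obtain j' k' l' where [simp]: "j = Suc j'" "k = Suc k'" "l = Suc l'"
          by (metis less_imp_Suc_add)
        show "?os ((0 # xs) ! i) ((0 # xs) ! j) ((0 # xs) ! k) ((0 # xs) ! l)"
        proof (cases i)
          case 0
          then show ?thesis
            using zero[of j' k' l'] * n by simp
        next
          case (Suc i')
          then show ?thesis
            using r[rule_format, of i' j' k' l'] * n by simp
        qed
      qed
    qed
    also have "\<dots> \<longleftrightarrow> (\<forall>i j k l. i < j \<longrightarrow> j < k \<longrightarrow> k < l \<longrightarrow> l < n \<longrightarrow> ?av i j k l)"
    proof -
      have "(i < j \<longrightarrow> j < k \<longrightarrow> k < l \<longrightarrow> l < n \<longrightarrow> ?os (xs ! i) (xs ! j) (xs ! k) (xs ! l)) \<longleftrightarrow>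
          (i < j \<longrightarrow> j < k \<longrightarrow> k < l \<longrightarrow> l < n \<longrightarrow> ?av i j k l)" for i j k l
        by (intro imp_cong refl main[symmetric])
      then show ?thesis
        by (simp only:)
    qed
    also have "\<dots> \<longleftrightarrow> avoids_word xs [3, 1, 4, 2] \<and> avoids_word xs [2, 4, 1, 3] \<and>
        avoids_word xs [-3, -1, -4, -2] \<and> avoids_word xs [-2, -4, -1, -3]"
      unfolding avoids_word_4 n
      by (simp only: insert_iff empty_iff de_Morgan_disj simp_thms imp_conjR all_conj_distrib)
    finally show ?thesis
      by (rule sym)
  qed
  have "(\<forall>u\<in>separable_patterns. avoids_word xs u) \<longleftrightarrow>
      (avoids_word xs [-2, 1] \<and> avoids_word xs [2, -1]) \<and>
      (avoids_word xs [3, 1, 4, 2] \<and> avoids_word xs [2, 4, 1, 3] \<and>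
       avoids_word xs [-3, -1, -4, -2] \<and> avoids_word xs [-2, -4, -1, -3])"
    unfolding separable_patterns_def by simp
  \<comment> \<open>\<open>four\<close> is available only under \<open>?opp\<close>, which the
    congruence rule supplies from the first conjunct.\<close>
  also have "\<dots> \<longleftrightarrow> ?opp \<and> order_separable (0 # xs)"
    unfolding two using four by (rule conj_cong[OF refl])
  also have "\<dots> \<longleftrightarrow> xs \<in> separable_signed_words n"
    using xs by (simp add: separable_signed_words_def signed_words_def)
  finally show ?thesis .
qed

section \<open>One-line notation as a bijection between signed permutations and words\<close>

lemma length_one_line [simp]: "length (one_line n w) = n"
  by (simp add: one_line_def)

lemma one_line_nth: "i < n \<Longrightarrow> one_line n w ! i = w (int i + 1)"
  by (simp add: one_line_def nth_upto add.commute)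

lemma set_one_line: "set (one_line n w) = w ` {1..int n}"
  by (simp add: one_line_def)

lemma one_line_signed_words:
  assumes "w \<in> signed_perms n"
  shows "one_line n w \<in> signed_words n"
proof -
  let ?D = "{- int n..int n} - {0}"
  have perm: "w permutes ?D" and neg: "\<And>i. i \<in> ?D \<Longrightarrow> w (- i) = - w i"
    using assms by (auto simp: signed_perms_def)
  have "abs ` w ` {1..int n} = {1..int n}"
  proof (rule card_subset_eq)
    have "w i \<in> ?D" if "i \<in> {1..int n}" for i
      using permutes_in_image[OF perm, of i] that by auto
    then show "abs ` w ` {1..int n} \<subseteq> {1..int n}"
      by (fastforce simp: abs_le_iff)
    have "inj_on (\<lambda>i. \<bar>w i\<bar>) {1..int n}"
    proof (rule inj_onI)
      fix i j assume ij: "i \<in> {1..int n}" "j \<in> {1..int n}" "\<bar>w i\<bar> = \<bar>w j\<bar>"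
      then have "w i = w j \<or> w i = w (- j)"
        using neg[of j] by (auto simp: abs_eq_iff)
      then have "i = j \<or> i = - j"
        using permutes_inj[OF perm] by (auto dest: injD)
      then show "i = j"
        using ij by auto
    qed
    then show "card (abs ` w ` {1..int n}) = card {1..int n}"
      by (simp add: image_image card_image)
  qed simp
  then show ?thesis
    by (simp add: signed_words_def set_one_line)
qed

text \<open>The inverse of \<open>one_line\<close>: odd on the nonzero indices and the identity
  elsewhere, as \<open>permutes\<close> requires.\<close>

definition word_perm :: "nat \<Rightarrow> int list \<Rightarrow> int \<Rightarrow> int" where
  "word_perm n xs i = (if i \<in> {1..int n} then xs ! nat (i - 1)
     else if - i \<in> {1..int n} then - (xs ! nat (- i - 1)) else i)"

lemma one_line_word_perm:
  assumes "xs \<in> signed_words n"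
  shows "one_line n (word_perm n xs) = xs"
  using assms by (intro nth_equalityI) (auto simp: signed_words_def one_line_nth word_perm_def)

lemma word_perm_signed_perms:
  assumes "xs \<in> signed_words n"
  shows "word_perm n xs \<in> signed_perms n"
proof -
  let ?D = "{- int n..int n} - {0}" and ?w = "word_perm n xs"
  have n: "length xs = n" "abs ` set xs = {1..int n}"
    using assms by (auto simp: signed_words_def)
  have val: "\<bar>?w i\<bar> = \<bar>xs ! nat (\<bar>i\<bar> - 1)\<bar>" "nat (\<bar>i\<bar> - 1) < n" if "i \<in> ?D" for i
    using that by (auto simp: word_perm_def abs_if)
  have neg: "?w (- i) = - ?w i" if "i \<in> ?D" for i
    using that by (auto simp: word_perm_def)
  have into: "?w i \<in> ?D" if "i \<in> ?D" for i
  proof -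
    have "\<bar>?w i\<bar> \<in> abs ` set xs"
      using val[OF that] n(1) by auto
    then show ?thesis
      unfolding n(2) by auto
  qed
  have "inj_on ?w ?D"
  proof (rule inj_onI)
    fix i j assume ij: "i \<in> ?D" "j \<in> ?D" "?w i = ?w j"
    then have "nat (\<bar>i\<bar> - 1) = nat (\<bar>j\<bar> - 1)"
      using val[of i] val[of j] signed_words_nth(2)[OF assms] by metis
    then have "i = j \<or> i = - j"
      using ij by auto
    moreover have "?w j \<noteq> 0"
      using into[OF ij(2)] by simp
    then have "?w (- j) \<noteq> ?w j"
      using neg[OF ij(2)] by simp
    ultimately show "i = j"
      using ij(3) by metis
  qed
  then have "bij_betw ?w ?D ?D"
    using into by (intro bij_betw_imageI endo_inj_surj) auto
  then have "?w permutes ?D"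
    by (rule bij_imp_permutes) (auto simp: word_perm_def)
  then show ?thesis
    using neg by (simp add: signed_perms_def)
qed

lemma one_line_inj: "inj_on (one_line n) (signed_perms n)"
proof (rule inj_onI, rule ext)
  fix w w' i assume ww: "w \<in> signed_perms n" "w' \<in> signed_perms n" "one_line n w = one_line n w'"
  have pos: "w i = w' i" if "i \<in> {1..int n}" for i
    using one_line_nth[of "nat (i - 1)" n w] one_line_nth[of "nat (i - 1)" n w'] ww(3) that by auto
  consider "i \<in> {1..int n}" | "- i \<in> {1..int n}" | "i \<notin> {- int n..int n} - {0}"
    by fastforce
  then show "w i = w' i"
  proof cases
    case 2
    then have "- i \<in> {- int n..int n} - {0}"
      by auto
    then have "w (- (- i)) = - w (- i)" "w' (- (- i)) = - w' (- i)"
      using ww unfolding signed_perms_def by blast+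
    then show ?thesis
      using pos[OF 2] by simp
  next
    case 3
    then show ?thesis
      using ww(1,2) permutes_not_in[of w _ i] permutes_not_in[of w' _ i]
      unfolding signed_perms_def mem_Collect_eq by metis
  qed (rule pos)
qed

lemma bij_betw_one_line: "bij_betw (one_line n) (signed_perms n) (signed_words n)"
proof (rule bij_betw_imageI[OF one_line_inj])
  show "one_line n ` signed_perms n = signed_words n"
    using one_line_signed_words one_line_word_perm word_perm_signed_perms
    by (metis (no_types, lifting) image_iff image_subsetI subset_antisym subsetI)
qed

lemma bij_betw_KB: "bij_betw (one_line n) (KB n) (separable_signed_words n)"
proof -
  have "bij_betw (one_line n) {w \<in> signed_perms n. \<forall>u\<in>separable_patterns. \<not> contains_pattern n w u}
      {xs \<in> signed_words n. \<forall>u\<in>separable_patterns. avoids_word xs u}"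
    by (rule bij_betw_Collect[OF bij_betw_one_line]) (simp add: contains_pattern_def avoids_word_def)
  moreover have "{xs \<in> signed_words n. \<forall>u\<in>separable_patterns. avoids_word xs u} = separable_signed_words n"
    using avoids_word_iff_sepB by (auto simp: separable_signed_words_def signed_words_def)
  ultimately show ?thesis
    by (simp add: KB_def)
qed

text \<open>A leading 0 below all letters is a sum component of its own.\<close>

lemma order_separable_Cons_0:
  assumes "\<forall>x\<in>set xs. 0 < x"
  shows "order_separable (0 # xs) \<longleftrightarrow> order_separable xs"
proof
  assume "order_separable xs"
  then have "order_separable ([0] @ xs)"
    using assms by (intro order_separable_append) (auto simp: order_separable_def)
  then show "order_separable (0 # xs)"
    by simp
next
  assume "order_separable (0 # xs)"
  then show "order_separable xs"
    by (rule order_separable_embed[where f = Suc]) auto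
qed

lemma sep_iff_sepB: "xs \<in> separable_words n \<longleftrightarrow> xs \<in> separable_signed_words n \<and> (\<forall>x\<in>set xs. 0 < x)"
proof (cases "\<forall>x\<in>set xs. 0 < x")
  case True
  then have "abs ` set xs = id ` set xs"
    by (intro image_cong) auto
  then have "abs ` set xs = set xs"
    by simp
  moreover have "\<not> xs ! i * xs ! j < 0" if "i < length xs" "j < length xs" for i j
  proof -
    have "0 < xs ! i" "0 < xs ! j"
      using True that by simp_all
    then show ?thesis
      by (simp add: mult_less_0_iff)
  qed
  ultimately show ?thesis
    using True order_separable_Cons_0[OF True] by (auto simp: separable_words_def separable_signed_words_def)
next
  case False
  then show ?thesis
    by (auto simp: separable_words_def)
qed

lemma bij_betw_KS: "bij_betw (one_line n) (KS n) (separable_words n)"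
proof -
  have "bij_betw (one_line n) {w \<in> KB n. \<forall>i\<in>{1..int n}. 0 < w i} {xs \<in> separable_signed_words n. \<forall>x\<in>set xs. 0 < x}"
    by (rule bij_betw_Collect[OF bij_betw_KB]) (simp add: set_one_line)
  moreover have "KS n = {w \<in> KB n. \<forall>i\<in>{1..int n}. 0 < w i}"
    by (auto simp: KS_def KB_def unsigned_perms_def)
  moreover have "separable_words n = {xs \<in> separable_signed_words n. \<forall>x\<in>set xs. 0 < x}"
    using sep_iff_sepB by blast
  ultimately show ?thesis
    by simp
qed

text \<open>Serves both types: \<open>a\<close> is 1 in type A, and 0 with the letter 0 prepended in
  type B. The guard \<open>ys \<noteq> []\<close> matters in type A, where for the empty word both
  boundary letters are infinity and do not compare.\<close>

lemma card_descents:
  fixes f :: "int \<Rightarrow> ereal"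
  assumes "\<And>k. k < length ys \<Longrightarrow> f (a + int k) = ereal (of_int (ys ! k))"
    and "f (a + int (length ys)) = \<infinity>"
  shows "card {i \<in> {a..a + int (length ys) - 1}. f i > f (i + 1)} = word_des ys"
    and "(ys \<noteq> [] \<Longrightarrow> f (a - 1) > f a \<longleftrightarrow> l) \<Longrightarrow>
      card {i \<in> {a..a + int (length ys) - 1}. f (i - 1) > f i \<and> f i > f (i + 1)} = word_dd l ys"
  using assms
proof (induction ys arbitrary: a l rule: induct_list012)
  case (2 x)
  {
    case 1
    then show ?case by simp
  next
    case 2
    then show ?case by simp
  }
next
  case (3 x y zs)
  have f: "f a = ereal (of_int x)" "f (a + 1) = ereal (of_int y)"
    if "\<And>k. k < length (x # y # zs) \<Longrightarrow> f (a + int k) = ereal (of_int ((x # y # zs) ! k))" for a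
    using that[of 0] that[of 1] by simp_all
  have shift: "f (a + 1 + int k) = ereal (of_int ((y # zs) ! k))"
    if "\<And>k. k < length (x # y # zs) \<Longrightarrow> f (a + int k) = ereal (of_int ((x # y # zs) ! k))"
      "k < length (y # zs)" for a k
    using that(1)[of "Suc k"] that(2) by (simp add: algebra_simps)
  have ivl: "{i \<in> {a..a + int (length (x # y # zs)) - 1}. P i} =
      (if P a then {a} else {}) \<union> {i \<in> {a + 1..a + 1 + int (length (y # zs)) - 1}. P i}" for P and a :: int
    by (auto simp: le_less)
  have card: "card {i \<in> {a..a + int (length (x # y # zs)) - 1}. P i} =
      of_bool (P a) + card {i \<in> {a + 1..a + 1 + int (length (y # zs)) - 1}. P i}" for P and a :: int
    unfolding ivl by (subst card_Un_disjoint)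
      (auto intro: finite_subset[of _ "{a + 1..1 + (a + int (length zs))}"])
  {
    case 1
    have "card {i \<in> {a + 1..a + 1 + int (length (y # zs)) - 1}. f i > f (i + 1)} = word_des (y # zs)"
      by (rule 3(3)) (use shift[OF 1(1)] 1(2) in \<open>simp_all add: algebra_simps\<close>)
    then show ?case
      unfolding card using f[OF 1(1)] by simp
  next
    case 2
    have "card {i \<in> {a + 1..a + 1 + int (length (y # zs)) - 1}. f (i - 1) > f i \<and> f i > f (i + 1)} =
        word_dd (y < x) (y # zs)"
      by (rule 3(4)) (use shift[OF 2(2)] f[OF 2(2)] 2(3) in \<open>simp_all add: algebra_simps\<close>)
    then show ?case
      unfolding card using f[OF 2(2)] 2(1) by simp
  }
qed simp_all

lemma des_A_eq: "des_A n w = word_des (one_line n w)"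
  and dd_A_eq: "dd_A n w = word_dd True (one_line n w)"
proof -
  have *: "letter_A n w (1 + int k) = ereal (of_int (one_line n w ! k))" if "k < length (one_line n w)" for k
    using that by (simp add: letter_A_def one_line_nth add.commute)
  have **: "letter_A n w (1 + int (length (one_line n w))) = \<infinity>" "letter_A n w (1 - 1) = \<infinity>"
    by (simp_all add: letter_A_def)
  show "des_A n w = word_des (one_line n w)"
    using card_descents(1)[OF * **(1)] by (simp add: des_A_def)
  have "(letter_A n w (1 - 1) > letter_A n w 1) = True" if "one_line n w \<noteq> []"
  proof -
    have "0 < length (one_line n w)"
      using that by blast
    then have "letter_A n w 1 < \<infinity>"
      using *[of 0] by simp
    then show ?thesis
      unfolding **(2) by simp
  qed
  from card_descents(2)[OF * **(1) this] show "dd_A n w = word_dd True (one_line n w)"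
    by (simp add: dd_A_def)
qed

lemma des_B_eq: "des_B n w = word_des (0 # one_line n w)"
  and dd_B_eq: "dd_B n w = word_dd True (0 # one_line n w)"
proof -
  have *: "letter_B n w (0 + int k) = ereal (of_int ((0 # one_line n w) ! k))"
    if "k < length (0 # one_line n w)" for k
    using that by (cases k) (simp_all add: letter_B_def one_line_nth add.commute)
  have **: "letter_B n w (0 + int (length (0 # one_line n w))) = \<infinity>"
    by (simp add: letter_B_def)
  show "des_B n w = word_des (0 # one_line n w)"
    using card_descents(1)[OF * **] by (simp add: des_B_def)
  have "(letter_B n w (0 - 1) > letter_B n w 0) = True"
    by (simp add: letter_B_def)
  from card_descents(2)[OF * ** this] show "dd_B n w = word_dd True (0 # one_line n w)"
    by (simp add: dd_B_def)
qed

section \<open>The polynomials and gamma coefficients in terms of words\<close>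

lemma poly_S_eq: "poly_S n = (\<Sum>xs\<in>separable_words n. monom 1 (word_des xs))"
  unfolding poly_S_def des_A_eq by (rule sum.reindex_bij_betw[OF bij_betw_KS])

lemma poly_B_eq: "poly_B n = (\<Sum>xs\<in>separable_signed_words n. monom 1 (word_des (0 # xs)))"
  unfolding poly_B_def des_B_eq by (rule sum.reindex_bij_betw[OF bij_betw_KB])

lemma gamma_S_eq: "gamma_S n k = card {xs \<in> separable_words n. word_dd True xs = 0 \<and> word_des xs = k}"
proof -
  have "bij_betw (one_line n) {w \<in> KS n. dd_A n w = 0 \<and> des_A n w = k}
      {xs \<in> separable_words n. word_dd True xs = 0 \<and> word_des xs = k}"
    by (rule bij_betw_Collect[OF bij_betw_KS]) (simp add: des_A_eq dd_A_eq)
  then show ?thesis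
    unfolding gamma_S_def by (rule bij_betw_same_card)
qed

lemma gamma_B_eq: "gamma_B n k = card {xs \<in> separable_signed_words n. word_dd True (0 # xs) = 0 \<and> word_des (0 # xs) = k}"
proof -
  have "bij_betw (one_line n) {w \<in> KB n. dd_B n w = 0 \<and> des_B n w = k}
      {xs \<in> separable_signed_words n. word_dd True (0 # xs) = 0 \<and> word_des (0 # xs) = k}"
    by (rule bij_betw_Collect[OF bij_betw_KB]) (simp add: des_B_eq dd_B_eq)
  then show ?thesis
    unfolding gamma_B_def by (rule bij_betw_same_card)
qed

lemma poly_B_eq_poly_S: "poly_B n = poly_S (n + 1)"
proof -
  have "poly_B n = (\<Sum>xs\<in>separable_signed_words n. monom 1 (word_des (standardize (0 # xs))))"
    unfolding poly_B_eq by (intro sum.cong refl) (simp add: standardize_descents)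
  also have "\<dots> = (\<Sum>xs\<in>separable_words (Suc n). monom 1 (word_des xs))"
    by (rule sum.reindex_bij_betw[OF bij_betw_standardize])
  finally show ?thesis
    by (simp add: poly_S_eq)
qed

lemma gamma_B_eq_gamma_S: "gamma_B n k = gamma_S (n + 1) k"
proof -
  have "bij_betw (\<lambda>xs. standardize (0 # xs)) {xs \<in> separable_signed_words n. word_dd True (0 # xs) = 0 \<and> word_des (0 # xs) = k}
      {xs \<in> separable_words (Suc n). word_dd True xs = 0 \<and> word_des xs = k}"
    by (rule bij_betw_Collect[OF bij_betw_standardize]) (simp add: standardize_descents)
  then show ?thesis
    unfolding gamma_B_eq gamma_S_eq by (simp add: bij_betw_same_card)
qed

text \<open>The identity has no descents. This makes the degree of the polynomial exactly
  \<open>n\<close>.\<close>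

lemma gamma_S_0_pos: "0 < gamma_S (n + 1) 0"
proof -
  let ?xs = "[1..int (n + 1)]"
  have "order_separable ?xs"
    by (auto simp: order_separable_def nth_upto)
  then have "?xs \<in> separable_words (n + 1)"
    by (simp add: separable_words_def)
  moreover have "word_des xs = 0 \<and> word_dd True xs = 0" if "sorted_wrt (<) xs" for xs
    using that
  proof (induction xs rule: induct_list012)
    case (3 x y zs)
    have "word_dd l xs = 0" if "sorted_wrt (<) xs" "\<not> l" for l xs
      using that by (induction l xs rule: word_dd.induct) auto
    with 3 show ?case by auto
  qed auto
  then have "word_des ?xs = 0 \<and> word_dd True ?xs = 0"
    by simp
  ultimately have "?xs \<in> {xs \<in> separable_words (n + 1). word_dd True xs = 0 \<and> word_des xs = 0}"
    by simp
  then show ?thesis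
    unfolding gamma_S_eq by (subst card_gt_0_iff) (auto simp: finite_sep)
qed

section \<open>Gamma expansions\<close>

lemma coeff_one_plus_X_power: "coeff ([:1, 1:] ^ m :: int poly) i = int (m choose i)"
proof (cases "i \<le> m")
  case False
  have "degree ([:1, 1:] ^ m :: int poly) \<le> m"
    using degree_power_le[of "[:1, 1:] :: int poly" m] by simp
  then show ?thesis
    using False by (simp add: coeff_eq_0 binomial_eq_0)
qed (simp add: coeff_linear_poly_power)

lemma coeff_gamma_expansion:
  fixes \<gamma> :: "nat \<Rightarrow> int"
  shows "coeff (gamma_expansion n \<gamma>) i =
    (\<Sum>k = 0..n div 2. if k \<le> i then \<gamma> k * int ((n - 2 * k) choose (i - k)) else 0)"
  unfolding gamma_expansion_def coeff_sum
  by (intro sum.cong) (auto simp: coeff_monom_mult coeff_one_plus_X_power)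

text \<open>Every summand t^k (1+t)^(n-2k) is symmetric about n/2, whatever k is. Outside its
  support the binomial coefficient or the guard \<open>k \<le> i\<close> gives 0, which accounts for
  the case distinction.\<close>

lemma gamma_expansion_symmetric:
  fixes \<gamma> :: "nat \<Rightarrow> int"
  assumes "i \<le> n"
  shows "coeff (gamma_expansion n \<gamma>) (n - i) = coeff (gamma_expansion n \<gamma>) i"
  unfolding coeff_gamma_expansion
proof (intro sum.cong refl)
  fix k assume k: "k \<in> {0..n div 2}"
  have "(n - 2 * k) choose (n - i - k) = (n - 2 * k) choose (i - k)" if "k \<le> i" "k \<le> n - i"
  proof -
    have "n - 2 * k - (i - k) = n - i - k" "i - k \<le> n - 2 * k"
      using that assms by auto
    then show ?thesis
      using binomial_symmetric[of "i - k" "n - 2 * k"] by metis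
  qed
  moreover have "(n - 2 * k) choose (i - k) = 0" if "k \<le> i" "\<not> k \<le> n - i"
    using that assms k by (intro binomial_eq_0) auto
  moreover have "(n - 2 * k) choose (n - i - k) = 0" if "\<not> k \<le> i" "k \<le> n - i"
    using that assms k by (intro binomial_eq_0) auto
  ultimately show "(if k \<le> n - i then \<gamma> k * int ((n - 2 * k) choose (n - i - k)) else 0) =
      (if k \<le> i then \<gamma> k * int ((n - 2 * k) choose (i - k)) else 0)"
    by auto
qed

text \<open>All summands share the centre n/2 and increase up to it, as binomial coefficients
  do.\<close>

lemma gamma_expansion_mono:
  fixes \<gamma> :: "nat \<Rightarrow> int"
  assumes "\<And>k. k \<le> n div 2 \<Longrightarrow> \<gamma> k \<ge> 0" "i < n div 2"
  shows "coeff (gamma_expansion n \<gamma>) i \<le> coeff (gamma_expansion n \<gamma>) (i + 1)"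
  unfolding coeff_gamma_expansion
proof (intro sum_mono)
  fix k assume k: "k \<in> {0..n div 2}"
  have "(n - 2 * k) choose (i - k) \<le> (n - 2 * k) choose (i + 1 - k)" if "k \<le> i"
    using that assms(2) k by (intro binomial_mono) auto
  then show "(if k \<le> i then \<gamma> k * int ((n - 2 * k) choose (i - k)) else 0) \<le>
      (if k \<le> i + 1 then \<gamma> k * int ((n - 2 * k) choose (i + 1 - k)) else 0)"
    using assms(1)[of k] k by (auto intro!: mult_left_mono)
qed

text \<open>Only k = 0 contributes to the constant coefficient, and symmetry moves it to degree
  \<open>n\<close>.\<close>

lemma degree_gamma_expansion:
  fixes \<gamma> :: "nat \<Rightarrow> int"
  assumes "\<gamma> 0 \<noteq> 0"
  shows "degree (gamma_expansion n \<gamma>) = n"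
proof (rule antisym)
  have "coeff (gamma_expansion n \<gamma>) i = 0" if "i > n" for i
    unfolding coeff_gamma_expansion using that
    by (intro sum.neutral) (auto intro!: binomial_eq_0)
  then show "degree (gamma_expansion n \<gamma>) \<le> n"
    by (simp add: degree_le)
  have "coeff (gamma_expansion n \<gamma>) 0 = (\<Sum>k = 0..n div 2. if k = 0 then \<gamma> 0 else 0)"
    unfolding coeff_gamma_expansion by (intro sum.cong) auto
  then have "coeff (gamma_expansion n \<gamma>) n \<noteq> 0"
    using assms gamma_expansion_symmetric[of n n \<gamma>] by simp
  then show "n \<le> degree (gamma_expansion n \<gamma>)"
    by (rule le_degree)
qed

lemma gamma_expansion_unimodal:
  fixes \<gamma> :: "nat \<Rightarrow> int"
  assumes nonneg: "\<And>k. k \<le> n div 2 \<Longrightarrow> \<gamma> k \<ge> 0" and "\<gamma> 0 \<noteq> 0"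
  shows "unimodal (gamma_expansion n \<gamma>)"
proof -
  let ?c = "coeff (gamma_expansion n \<gamma>)"
  have "?c (i + 1) \<le> ?c i" if i: "i \<in> {n div 2..<n}" for i
  \<comment> \<open>For odd \<open>n\<close> the two middle coefficients coincide by symmetry; every
    other step of the right half is reflected into the left half.\<close>
  proof (cases "2 * i + 1 = n")
    case True
    then show ?thesis
      using gamma_expansion_symmetric[of i n \<gamma>] by (simp add: True[symmetric])
  next
    case False
    then have "n - i - 1 < n div 2" "n - i - 1 + 1 = n - i"
      using i by auto
    then have "?c (n - i - 1) \<le> ?c (n - i)"
      using gamma_expansion_mono[of n \<gamma> "n - i - 1"] nonneg by simp
    then show ?thesis
      using i gamma_expansion_symmetric[of i n \<gamma>] gamma_expansion_symmetric[of "i + 1" n \<gamma>]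
      by simp
  qed
  then show ?thesis
    unfolding unimodal_def degree_gamma_expansion[of \<gamma> n, OF assms(2)]
    using gamma_expansion_mono[OF nonneg] by (intro exI[of _ "n div 2"]) auto
qed

theorem theorem4p8:
  fixes n :: nat
  shows "poly_B n = poly_S (n + 1) \<and>
    poly_B n = gamma_expansion n (\<lambda>k. int (gamma_B n k)) \<and>
    (\<forall>k. gamma_B n k = gamma_S (n + 1) k) \<and>
    gamma_positive n (poly_B n) \<and>
    degree (poly_B n) = n \<and>
    palindromic (poly_B n) \<and>
    unimodal (poly_B n)"
proof -
  let ?\<gamma> = "\<lambda>k. int (gamma_B n k)"
  have \<gamma>: "?\<gamma> 0 \<noteq> 0" "\<And>k. ?\<gamma> k \<ge> 0"
    using gamma_S_0_pos[of n] by (simp_all add: gamma_B_eq_gamma_S)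
  have expansion: "poly_B n = gamma_expansion n ?\<gamma>"
    unfolding poly_B_eq_poly_S poly_S_eq sep_gamma_expansion gamma_B_eq_gamma_S gamma_S_eq ..
  have degree: "degree (poly_B n) = n"
    unfolding expansion using \<gamma>(1) by (rule degree_gamma_expansion)
  have "palindromic (poly_B n)"
    unfolding palindromic_def degree using gamma_expansion_symmetric by (simp add: expansion)
  moreover have "unimodal (poly_B n)"
    unfolding expansion using \<gamma> by (intro gamma_expansion_unimodal)
  moreover have "gamma_positive n (poly_B n)"
    unfolding gamma_positive_def using expansion \<gamma>(2) by (intro exI[of _ ?\<gamma>]) simp
  ultimately show ?thesis
    using poly_B_eq_poly_S expansion gamma_B_eq_gamma_S degree by blast
qed

end
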